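(* Let $\tau>0$, let $x^*>0$ be the location of the first negative extremum of $y_1(\cdot;\tau)$, and write the singular value decomposition of $\Phi(x^*;\tau)$ in the form $$\begin{pmatrix} y_0(x^*;\tau) & y_1(x^*;\tau) \\ z_0(x^*;\tau) & z_1(x^*;\tau) \end{pmatrix}=\begin{pmatrix} a & -b \\ b & a \end{pmatrix}\begin{pmatrix} \alpha\sqrt{x^*} & 0 \\ 0 & \alpha^{-1}\sqrt{x^*} \end{pmatrix}\begin{pmatrix} c & d \\ -d & c \end{pmatrix},$$ with real $a,b,c,d$, $a^2+b^2=1$, $c^2+d^2=1$, $\alpha>0$. Let $\tilde m=\tilde m(\tau^+)$, $\beta=c/d$ (and $\beta^{-1}=d/c$), and $\mu=\frac{a+b\tilde m}{b-a\tilde m}$. Then $$m(\tau^+)=-\beta+\frac{1+\beta^2}{\alpha^2\mu^{-1}+\beta}\quad(\text{if } d\neq0),\qquad m(\tau^+)=\beta^{-1}-\frac{1+\beta^{-2}}{\alpha^{-2}\mu+\beta^{-1}}\quad(\text{if }c\ne0),$$ and consequently the spectral density function satisfies $$\rho'(\tau)=\begin{cases} \frac1\pi\operatorname{Im}\left\{\frac{1+\beta^2}{\alpha^2\mu^{-1}+\beta}\right\}, & |\beta|\le1, \\[4pt] -\frac1\pi\operatorname{Im}\left\{\frac{1+\beta^{-2}}{\alpha^{-2}\mu+\beta^{-1}}\right\}, & |\beta|>1. \end{cases}$$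
   Context: Let $\operatorname{erf}(x)=\frac{2}{\sqrt\pi}\int_0^x e^{-s^2}\,ds$, $\Psi(x)=\frac{1}{2x^3}\left[\operatorname{erf}(x)-\frac{2}{\sqrt\pi}xe^{-x^2}\right]$ (with $\Psi(0)=\frac{2}{3\sqrt\pi}$), and $w(x)=x^2e^{-x^2}$. For $\lambda\in\mathbb{C}$ consider the ODE $-(\Psi w u')'=\lambda w u$ on $(0,\infty)$. With $y(x)=xe^{-x^2/2}u(x)$ and $z(x)=\Psi(x)x^2e^{-x^2/2}u'(x)$ it is equivalent to the first-order system $$\frac{d}{dx}\begin{pmatrix} y \\ z \end{pmatrix}=\frac1x\begin{pmatrix} 1-x^2 & \Psi(x)^{-1} \\ -\lambda x^2 & x^2 \end{pmatrix}\begin{pmatrix} y \\ z \end{pmatrix},$$ all of whose solutions extend analytically to a neighborhood of $x=0$. Let $(y_1,z_1)$ be the solution that is odd in $x$ with $y_1'(0)=1$, and $(y_0,z_0)$ the solution that is even in $x$ with $y_0(0)=\frac{3\sqrt\pi}{2}$, $z_0(0)=-1$; set $\Phi(x;\lambda)=\begin{pmatrix} y_0 & y_1 \\ z_0 & z_1 \end{pmatrix}$, so that $\det\Phi(x;\lambda)=x$. For $\lambda\in\mathbb{C}\setminus\mathbb{R}$ the Titchmarsh--Weyl $m$-function is $m(\lambda)=-\lim_{x\to\infty}\frac{y_0(x;\lambda)}{y_1(x;\lambda)}$. It is analytic on $\mathbb{C}\setminus\mathbb{R}$ with $\operatorname{Im} m>0$ in the upper half-plane. For $\tau>0$, $m(\tau^+)=\lim_{\varepsilon\to0^+}m(\tau+i\varepsilon)$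 exists and is finite, and the spectral density function is $\rho'(\tau)=\frac1\pi\operatorname{Im}\{m(\tau^+)\}>0$. The "first negative extremum" of $y_1(\cdot;\tau)$ is at the smallest $x>0$ where $y_1(\cdot;\tau)$ has a local extremum with negative value. With $\tau$ (hence $x^*$) fixed, for $\lambda=\tau+i\varepsilon$ let $\tilde\Phi(x;\lambda)=\begin{pmatrix} \tilde y_0 & \tilde y_1 \\ \tilde z_0 & \tilde z_1 \end{pmatrix}$ be the fundamental matrix of the same system with $\tilde\Phi(x^*;\lambda)=I$. For $\varepsilon>0$ put $\tilde m(\lambda)=-\lim_{x\to\infty}\frac{\tilde y_0(x;\lambda)}{\tilde y_1(x;\lambda)}$ (this limit exists), and $\tilde m(\tau^+)=\lim_{\varepsilon\to0^+}\tilde m(\tau+i\varepsilon)$ (this limit exists). If $d=0$, interpret $|\beta|=\infty>1$ and $\beta^{-1}=0$. *)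

theory Defs
  imports "HOL-Analysis.Analysis"
begin

(* The interval integral is oriented, so this is the odd error function on the whole real line. *)
definition erf :: "real \<Rightarrow> real" where
  "erf x = 2 / sqrt pi * (LBINT s=0..x. exp (- (s ^ 2)))"

definition Psi :: "real \<Rightarrow> real" where
  "Psi x = (if x = 0 then 2 / (3 * sqrt pi)
            else 1 / (2 * x ^ 3) * (erf x - 2 / sqrt pi * x * exp (- (x ^ 2))))"

(* The first-order system, row by row, for (y, z) = (x exp(-x^2/2) u, Psi(x) x^2 exp(-x^2/2) u'),
   where -(Psi w u')' = lambda w u and w(x) = x^2 exp(-x^2). *)
definition system_solution ::
    "real set \<Rightarrow> complex \<Rightarrow> (real \<Rightarrow> complex) \<Rightarrow> (real \<Rightarrow> complex) \<Rightarrow> bool" where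
  "system_solution S lam y z \<longleftrightarrow>
     (\<forall>x\<in>S.
        (y has_vector_derivative
           of_real (1 / x) * (of_real (1 - x ^ 2) * y x + of_real (inverse (Psi x)) * z x)) (at x) \<and>
        (z has_vector_derivative
           of_real (1 / x) * (- lam * of_real (x ^ 2) * y x + of_real (x ^ 2) * z x)) (at x))"

definition analytic_at_zero :: "(real \<Rightarrow> complex) \<Rightarrow> bool" where
  "analytic_at_zero f \<longleftrightarrow>
     (\<exists>g. g analytic_on {0} \<and> (\<forall>\<^sub>F x in nhds 0. f x = g (of_real x)))"

(* Psi is even, so the system makes sense for all nonzero real x. Analyticity at 0 matters for
   y0: without it, evenness would not exclude adding multiples of |y1|. *)
definition analytic_solution ::
    "complex \<Rightarrow> (real \<Rightarrow> complex) \<Rightarrow> (real \<Rightarrow> complex) \<Rightarrow> bool" where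
  "analytic_solution lam y z \<longleftrightarrow>
     system_solution (UNIV - {0}) lam y z \<and> analytic_at_zero y \<and> analytic_at_zero z"

definition even_solution ::
    "complex \<Rightarrow> (real \<Rightarrow> complex) \<Rightarrow> (real \<Rightarrow> complex) \<Rightarrow> bool" where
  "even_solution lam y z \<longleftrightarrow>
     analytic_solution lam y z \<and> (\<forall>x. y (- x) = y x \<and> z (- x) = z x) \<and>
     y 0 = of_real (3 * sqrt pi / 2) \<and> z 0 = - 1"

definition odd_solution ::
    "complex \<Rightarrow> (real \<Rightarrow> complex) \<Rightarrow> (real \<Rightarrow> complex) \<Rightarrow> bool" where
  "odd_solution lam y z \<longleftrightarrow>
     analytic_solution lam y z \<and> (\<forall>x. y (- x) = - y x \<and> z (- x) = - z x) \<and>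
     (y has_vector_derivative 1) (at 0)"

definition mat22 :: "complex \<Rightarrow> complex \<Rightarrow> complex \<Rightarrow> complex \<Rightarrow> complex ^ 2 ^ 2" where
  "mat22 p q r s = vector [vector [p, q], vector [r, s]]"

(* (f, g) = (y0, y1) gives m, and (f, g) = (y0~, y1~) gives m~. *)
definition weyl_m ::
    "(complex \<Rightarrow> real \<Rightarrow> complex) \<Rightarrow> (complex \<Rightarrow> real \<Rightarrow> complex) \<Rightarrow> complex \<Rightarrow> complex" where
  "weyl_m f g lam = - Lim at_top (\<lambda>x. f lam x / g lam x)"

definition upper_limit :: "(complex \<Rightarrow> complex) \<Rightarrow> real \<Rightarrow> complex" where
  "upper_limit m \<tau> = Lim (at_right 0) (\<lambda>\<epsilon>. m (Complex \<tau> \<epsilon>))"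

definition spectral_density :: "(complex \<Rightarrow> complex) \<Rightarrow> real \<Rightarrow> real" where
  "spectral_density m \<tau> = 1 / pi * Im (upper_limit m \<tau>)"

definition local_extremum :: "(real \<Rightarrow> real) \<Rightarrow> real \<Rightarrow> bool" where
  "local_extremum f x \<longleftrightarrow> (\<forall>\<^sub>F t in nhds x. f t \<le> f x) \<or> (\<forall>\<^sub>F t in nhds x. f x \<le> f t)"

definition first_negative_extremum :: "(real \<Rightarrow> real) \<Rightarrow> real \<Rightarrow> bool" where
  "first_negative_extremum f xs \<longleftrightarrow>
     xs > 0 \<and> local_extremum f xs \<and> f xs < 0 \<and>
     (\<forall>x. 0 < x \<and> local_extremum f x \<and> f x < 0 \<longrightarrow> xs \<le> x)"

end

theory Submission
  imports Defs
begin

text \<open>Since \<open>\<Phi> = \<Phi>\<^sup>~ \<Phi>(x\<^sup>*)\<close>, the number \<open>m(\<lambda>)\<close> is the image of \<open>m\<^sup>~(\<lambda>)\<close> under the Moebius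
  transformation with matrix entries from \<open>\<Phi>(x\<^sup>*; \<lambda>)\<close>; letting \<open>\<lambda> \<rightarrow> \<tau>\<close> and inserting the singular
  value decomposition gives the formulas. What has to be proved is that all the limits exist, that
  \<open>Im m\<^sup>~(\<tau>\<^sup>+) > 0\<close> (so that no denominator vanishes), and that \<open>\<Phi>(x\<^sup>*; \<lambda>)\<close> is continuous in \<open>\<lambda>\<close>.

  For the limits, take an approximate WKB solution \<open>r(x; \<lambda>)\<close> in the lower half-plane of the Riccati
  equation for \<open>y / z\<close>, whose defect is \<open>O(1/x)\<close>, and the approximants
  \<open>q = - (y\<^sub>0 - r z\<^sub>0) / (y\<^sub>1 - r z\<^sub>1)\<close>. Here \<open>q'\<close> is the defect times \<open>det \<Phi>\<close> divided by the square of the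
  denominator, and the denominator grows at least like \<open>x\<^bsup>3/4\<^esup>\<close>, uniformly for \<open>\<lambda> = \<tau> + \<i>\<epsilon>\<close>,
  \<open>0 \<le> \<epsilon> \<le> \<tau>\<close>. Hence \<open>q\<close> converges as \<open>x \<rightarrow> \<infinity>\<close> uniformly up to the real axis, and for
  \<open>\<epsilon> > 0\<close> the limit is that of \<open>- y\<^sub>0 / y\<^sub>1\<close>.

  Continuity in \<open>\<lambda>\<close> is variation of constants: the coefficients of a solution for \<open>\<lambda>\<close> with respect
  to \<open>\<Phi>(x; \<tau>)\<close> satisfy a linear system with right-hand side \<open>O(\<lambda> - \<tau>)\<close> that is regular at
  \<open>x = 0\<close>, and parity fixes their values there.\<close>

section \<open>The coefficient \<open>1 / (x \<Psi>(x))\<close>\<close>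

text \<open>The bracket in the definition of \<open>Psi\<close>: for \<open>x \<noteq> 0\<close>,
  \<open>Psi x = Eaux x / (2 * x ^ 3)\<close>.\<close>

definition Eaux :: "real \<Rightarrow> real" where
  "Eaux x = erf x - 2 / sqrt pi * x * exp (- (x ^ 2))"

lemma erf_deriv: "(erf has_real_derivative 2 / sqrt pi * exp (- (x ^ 2))) (at x)"
proof -
  \<comment> \<open>Both 0 and \<open>x\<close> are interior to \<open>{-c..c}\<close>, so the
    derivative within that interval supplied by the fundamental theorem is an ordinary one.\<close>
  define c where "c = \<bar>x\<bar> + 1"
  have c: "- c \<le> 0" "0 \<le> c" "-c < x" "x < c" by (auto simp: c_def)
  have "((\<lambda>u. LBINT y=ereal 0..u. exp (- (y ^ 2))) has_vector_derivative exp (- (x ^ 2)))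
      (at x within {-c..c})"
    by (rule interval_integral_FTC2) (use c in \<open>auto intro!: continuous_intros\<close>)
  moreover have "at x within {-c..c} = at x"
    using c by (intro at_within_interior) auto
  ultimately have "((\<lambda>u. LBINT y=0..u. exp (- (y ^ 2))) has_real_derivative exp (- (x ^ 2))) (at x)"
    by (simp add: has_real_derivative_iff_has_vector_derivative zero_ereal_def)
  then have "((\<lambda>u. 2 / sqrt pi * (LBINT y=0..u. exp (- (y ^ 2)))) has_real_derivative
      2 / sqrt pi * exp (- (x ^ 2))) (at x)"
    by (rule DERIV_cmult)
  moreover have "erf = (\<lambda>u. 2 / sqrt pi * (LBINT y=0..u. exp (- (y ^ 2))))"
    by (rule ext) (rule erf_def)
  ultimately show ?thesis by simp
qed

lemma Eaux_deriv: "(Eaux has_real_derivative 4 / sqrt pi * x ^ 2 * exp (- (x ^ 2))) (at x)"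
  unfolding Eaux_def [abs_def]
  by (rule derivative_eq_intros erf_deriv refl | simp)+ (simp add: field_simps power2_eq_square)

lemma Eaux_strict_mono: assumes "0 \<le> x" "x < y" shows "Eaux x < Eaux y"
proof (rule DERIV_pos_imp_increasing_open[OF assms(2)])
  fix t assume t: "x < t" "t < y"
  with assms show "\<exists>d. DERIV Eaux t :> d \<and> 0 < d"
    by (intro exI [of _ "4 / sqrt pi * t ^ 2 * exp (- (t ^ 2))"] conjI Eaux_deriv) simp
qed (auto intro!: continuous_at_imp_continuous_on DERIV_isCont Eaux_deriv)

lemma Eaux_pos: "0 < x \<Longrightarrow> 0 < Eaux x"
proof -
  have "Eaux 0 = 0" by (simp add: Eaux_def erf_def zero_ereal_def [symmetric])
  then show "0 < x \<Longrightarrow> 0 < Eaux x" using Eaux_strict_mono[of 0 x] by simp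
qed

text \<open>This is \<open>1 + t \<le> exp t\<close> at \<open>t = x ^ 2 / 3\<close>, raised to the
  third power.\<close>

lemma exp_square_bound: "x ^ 6 * exp (- (x ^ 2)) \<le> (27::real)"
proof -
  have "(x ^ 2 / 3) ^ 3 \<le> (1 + x ^ 2 / 3) ^ 3"
    by (intro power_mono) auto
  also have "\<dots> \<le> exp (x ^ 2 / 3) ^ 3"
    by (intro power_mono exp_ge_add_one_self) auto
  also have "\<dots> = exp (x ^ 2)"
    by (simp add: exp_of_nat_mult [symmetric])
  finally have "x ^ 6 \<le> 27 * exp (x ^ 2)"
    by (simp add: power_divide power_mult [symmetric])
  then show ?thesis
    by (simp add: exp_minus field_simps)
qed

text \<open>The derivative of \<open>Eaux\<close> is at most \<open>4 * 27 / t ^ 4\<close>, and that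
  of \<open>36 / t ^ 3\<close> is \<open>- 108 / t ^ 4\<close>. Consequently \<open>Eaux\<close>
  approaches its supremum at the rate O(1/x^3).\<close>

lemma Eaux_add_decreasing:
  assumes "0 < x" "x \<le> y" shows "Eaux y + 36 / y ^ 3 \<le> Eaux x + 36 / x ^ 3"
proof (rule DERIV_nonpos_imp_nonincreasing [OF assms(2)])
  fix t assume t: "x \<le> t" "t \<le> y"
  with assms have t0: "t > 0" by simp
  have "((\<lambda>t. Eaux t + 36 / t ^ 3) has_real_derivative
      4 / sqrt pi * t ^ 2 * exp (- (t ^ 2)) - 108 / t ^ 4) (at t)"
    using t0 by (auto intro!: derivative_eq_intros Eaux_deriv simp: field_simps power2_eq_square eval_nat_numeral)
  moreover have "4 / sqrt pi * t ^ 2 * exp (- (t ^ 2)) \<le> 108 / t ^ 4"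
  proof -
    have "1 \<le> sqrt pi" using pi_gt3 by simp
    then have "4 / sqrt pi \<le> 4" by (simp add: field_simps)
    then have "4 / sqrt pi * (t ^ 2 * exp (- (t ^ 2))) \<le> 4 * (t ^ 2 * exp (- (t ^ 2)))"
      by (intro mult_right_mono) auto
    moreover have "t ^ 2 * exp (- (t ^ 2)) \<le> 27 / t ^ 4"
      using exp_square_bound[of t] t0 by (simp add: field_simps power_add [symmetric])
    ultimately show ?thesis by simp
  qed
  ultimately show "\<exists>d. ((\<lambda>t. Eaux t + 36 / t ^ 3) has_real_derivative d) (at t) \<and> d \<le> 0"
    by (intro exI conjI) auto
qed

text \<open>In fact \<open>Einf = 1\<close>, but only its existence and positivity matter.\<close>

definition Einf :: real where "Einf = (SUP x\<in>{0<..}. Eaux x)"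

lemma Eaux_bdd: "bdd_above (Eaux ` {0<..})"
proof (rule bdd_aboveI2)
  fix x :: real assume "x \<in> {0<..}"
  then have x: "0 < x" by simp
  show "Eaux x \<le> Eaux 1 + 36"
  proof (cases "x \<le> 1")
    case True
    then show ?thesis using Eaux_strict_mono[of x 1] x by (cases "x = 1") auto
  next
    case False
    then have "Eaux x + 36 / x ^ 3 \<le> Eaux 1 + 36"
      using Eaux_add_decreasing[of 1 x] by simp
    moreover have "36 / x ^ 3 \<ge> 0" using x by simp
    ultimately show ?thesis by linarith
  qed
qed

lemma Eaux_le_Einf: "0 < x \<Longrightarrow> Eaux x \<le> Einf"
  unfolding Einf_def by (rule cSUP_upper[OF _ Eaux_bdd]) auto

lemma Einf_pos: "0 < Einf"
  using Eaux_pos[of 1] Eaux_le_Einf[of 1] by simp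

lemma Einf_le: assumes "0 < x" shows "Einf \<le> Eaux x + 36 / x ^ 3"
  unfolding Einf_def
proof (rule cSUP_least)
  fix y :: real assume "y \<in> {0<..}"
  then have y: "0 < y" by simp
  show "Eaux y \<le> Eaux x + 36 / x ^ 3"
  proof (cases "y \<le> x")
    case True
    then have "Eaux y \<le> Eaux x" using Eaux_strict_mono[of y x] y by (cases "x = y") auto
    moreover have "36 / x ^ 3 \<ge> 0" using assms by simp
    ultimately show ?thesis by linarith
  next
    case False
    then have "Eaux y + 36 / y ^ 3 \<le> Eaux x + 36 / x ^ 3"
      using Eaux_add_decreasing[of x y] assms by simp
    moreover have "36 / y ^ 3 \<ge> 0" using y by simp
    ultimately show ?thesis by linarith
  qed
qed auto

definition pcoef :: "real \<Rightarrow> real" where "pcoef x = inverse (Psi x) / x"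

lemma pcoef_eq: assumes "0 < x" shows "pcoef x = 2 * x ^ 2 / Eaux x"
proof -
  have "Psi x = Eaux x / (2 * x ^ 3)"
    using assms by (simp add: Psi_def Eaux_def)
  then have "pcoef x = 2 * x ^ 3 / Eaux x / x" by (simp add: pcoef_def)
  then show ?thesis using assms by (simp add: eval_nat_numeral)
qed

lemma pcoef_lower: "0 < x \<Longrightarrow> 2 / Einf * x ^ 2 \<le> pcoef x"
  using Eaux_pos[of x] Eaux_le_Einf[of x] by (simp add: pcoef_eq frac_le)

text \<open>Since \<open>Einf - Eaux x \<le> 36 / x ^ 3\<close>, replacing \<open>pcoef x\<close> by
  its leading term costs O(1/x), the order allowed for the defect of the approximate Riccati
  solution.\<close>

lemma pcoef_upper:
  assumes "1 \<le> x" shows "pcoef x - 2 / Einf * x ^ 2 \<le> 72 / (Eaux 1 * Einf) / x"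
proof -
  have x: "0 < x" using assms by simp
  have E1: "0 < Eaux 1" "Eaux 1 \<le> Eaux x"
    using assms Eaux_pos[of 1] Eaux_strict_mono[of 1 x] by (cases "x = 1"; auto)+
  have "pcoef x - 2 / Einf * x ^ 2 = 2 * x ^ 2 * (Einf - Eaux x) / (Eaux x * Einf)"
    using Eaux_pos[OF x] Einf_pos by (simp add: pcoef_eq x field_simps)
  also have "\<dots> \<le> 2 * x ^ 2 * (36 / x ^ 3) / (Eaux 1 * Einf)"
    using Einf_le[OF x] Eaux_le_Einf[OF x] E1 Einf_pos x
    by (intro frac_le mult_mono) auto
  also have "\<dots> = 72 / (Eaux 1 * Einf) / x"
    using x by (simp add: field_simps eval_nat_numeral)
  finally show ?thesis .
qed

section \<open>Continuous dependence on the spectral parameter\<close>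

lemma has_vector_derivative_divide_real:
  assumes "(f has_vector_derivative f') (at x)" "x \<noteq> 0"
  shows "((\<lambda>x. f x / complex_of_real x) has_vector_derivative
           f' / of_real x - f x / of_real x ^ 2) (at x)"
proof -
  have "((\<lambda>x. complex_of_real (1 / x)) has_vector_derivative of_real (- (1 / x ^ 2))) (at x)"
    by (rule bounded_linear.has_vector_derivative[OF bounded_linear_of_real])
       (use assms(2) in \<open>auto intro!: derivative_eq_intros
          simp: has_real_derivative_iff_has_vector_derivative [symmetric] power2_eq_square\<close>)
  from has_vector_derivative_mult[OF assms(1) this] show ?thesis
    by (simp add: field_simps)
qed

lemma system_solution_iff:
  assumes "system_solution S lam y z" "x \<in> S" "0 < x"
  shows "(y has_vector_derivative of_real (1 / x - x) * y x + of_real (pcoef x) * z x) (at x)"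
    and "(z has_vector_derivative of_real x * z x - lam * of_real x * y x) (at x)"
proof -
  have "of_real (1 / x) * (of_real (1 - x ^ 2) * y x + of_real (inverse (Psi x)) * z x)
      = of_real (1 / x - x) * y x + of_real (pcoef x) * z x"
    using assms(3) by (simp add: pcoef_def field_simps power2_eq_square)
  moreover have "of_real (1 / x) * (- lam * of_real (x ^ 2) * y x + of_real (x ^ 2) * z x)
      = of_real x * z x - lam * of_real x * y x"
    using assms(3) by (simp add: field_simps power2_eq_square)
  ultimately show "(y has_vector_derivative of_real (1 / x - x) * y x + of_real (pcoef x) * z x) (at x)"
    and "(z has_vector_derivative of_real x * z x - lam * of_real x * y x) (at x)"
    using assms(1,2) unfolding system_solution_def by auto
qed

lemma system_solution_subset: "system_solution S lam y z \<Longrightarrow> T \<subseteq> S \<Longrightarrow> system_solution T lam y z"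
  unfolding system_solution_def by auto

lemma system_solution_isCont:
  assumes "system_solution S lam y z" "x \<in> S"
  shows "isCont y x" "isCont z x"
  using assms has_vector_derivative_continuous unfolding system_solution_def by blast+

text \<open>For real \<open>lam\<close> this will show that real initial data give real
  solutions.\<close>

lemma system_solution_cnj:
  assumes "system_solution S lam y z"
  shows "system_solution S (cnj lam) (\<lambda>x. cnj (y x)) (\<lambda>x. cnj (z x))"
  unfolding system_solution_def
proof (intro ballI conjI)
  fix x assume "x \<in> S"
  then have
    "(y has_vector_derivative
       of_real (1 / x) * (of_real (1 - x ^ 2) * y x + of_real (inverse (Psi x)) * z x)) (at x)"
    "(z has_vector_derivative
       of_real (1 / x) * (- lam * of_real (x ^ 2) * y x + of_real (x ^ 2) * z x)) (at x)"
    using assms unfolding system_solution_def by auto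
  from this[THEN has_vector_derivative_cnj] show
    "((\<lambda>x. cnj (y x)) has_vector_derivative
       of_real (1 / x) * (of_real (1 - x ^ 2) * cnj (y x) + of_real (inverse (Psi x)) * cnj (z x))) (at x)"
    "((\<lambda>x. cnj (z x)) has_vector_derivative
       of_real (1 / x) * (- cnj lam * of_real (x ^ 2) * cnj (y x) + of_real (x ^ 2) * cnj (z x))) (at x)"
    by simp_all
qed

text \<open>The coefficient matrix has trace 1/x, so division by \<open>x\<close> removes the growth
  common to all Wronskians. What remains comes from the entries \<open>- lam * x\<close> and
  \<open>- mu * x\<close> alone.\<close>

lemma wronskian_deriv:
  assumes "system_solution S lam y z" "system_solution S mu Y Z" "x \<in> S" "0 < x"
  shows "((\<lambda>x. (y x * Z x - z x * Y x) / of_real x) has_vector_derivative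
           (lam - mu) * y x * Y x) (at x)"
proof -
  note d = system_solution_iff[OF assms(1) assms(3,4)] system_solution_iff[OF assms(2) assms(3,4)]
  have "((\<lambda>x. (y x * Z x - z x * Y x) / of_real x) has_vector_derivative
      (y x * (of_real x * Z x - mu * of_real x * Y x)
        + (of_real (1 / x - x) * y x + of_real (pcoef x) * z x) * Z x
       - (z x * (of_real (1 / x - x) * Y x + of_real (pcoef x) * Z x)
        + (of_real x * z x - lam * of_real x * y x) * Y x)) / of_real x
      - (y x * Z x - z x * Y x) / of_real x ^ 2) (at x)"
    using assms(4)
    by (intro has_vector_derivative_divide_real has_vector_derivative_diff
        has_vector_derivative_mult d) auto
  then show ?thesis
    by (rule back_subst[where P = "\<lambda>d. (_ has_vector_derivative d) _"])
       (use assms(4) in \<open>simp add: field_simps power2_eq_square\<close>)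
qed

lemma wronskian_const:
  assumes "system_solution {0<..} lam y z" "system_solution {0<..} lam Y Z" "0 < x" "0 < x'"
  shows "(y x * Z x - z x * Y x) / of_real x = (y x' * Z x' - z x' * Y x') / of_real x'"
proof -
  have "\<exists>c. \<forall>x\<in>{0<..}. (y x * Z x - z x * Y x) / of_real x = c"
  proof (rule has_vector_derivative_zero_constant)
    fix x :: real assume "x \<in> {0<..}"
    then show "((\<lambda>x. (y x * Z x - z x * Y x) / of_real x) has_vector_derivative 0) (at x within {0<..})"
      using wronskian_deriv[OF assms(1,2), of x] by (auto intro: has_vector_derivative_at_within)
  qed auto
  then show ?thesis using assms(3,4) by auto
qed

text \<open>A maximum argument in place of Gronwall's inequality. If n is the maximum of |c0| +
  |c1|, each coefficient moves by at most K (b - a) n \<le> n / 4, so n is at most its initial value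
  plus n / 2, hence at most twice the initial value. In the application \<open>K\<close> carries the
  factor |lam - tau|, so the smallness condition holds near \<open>tau\<close>.\<close>

lemma perturbation_bound:
  fixes c0 c1 f0 f1 :: "real \<Rightarrow> complex" and K :: real
  assumes "a < b" "continuous_on {a..b} c0" "continuous_on {a..b} c1"
    and d0: "\<And>x. a < x \<Longrightarrow> x < b \<Longrightarrow> (c0 has_vector_derivative f0 x) (at x)"
    and d1: "\<And>x. a < x \<Longrightarrow> x < b \<Longrightarrow> (c1 has_vector_derivative f1 x) (at x)"
    and b0: "\<And>x. a < x \<Longrightarrow> x < b \<Longrightarrow> norm (f0 x) \<le> K * (norm (c0 x) + norm (c1 x))"
    and b1: "\<And>x. a < x \<Longrightarrow> x < b \<Longrightarrow> norm (f1 x) \<le> K * (norm (c0 x) + norm (c1 x))"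
    and K: "0 \<le> K" "K * (b - a) \<le> 1 / 4"
  shows "norm (c0 b - c0 a) \<le> 2 * K * (b - a) * (norm (c0 a) + norm (c1 a))"
    and "norm (c1 b - c1 a) \<le> 2 * K * (b - a) * (norm (c0 a) + norm (c1 a))"
proof -
  let ?n = "\<lambda>x. norm (c0 x) + norm (c1 x)"
  have "\<exists>m\<in>{a..b}. \<forall>x\<in>{a..b}. ?n x \<le> ?n m"
    by (rule continuous_attains_sup) (use assms in \<open>auto intro!: continuous_intros\<close>)
  then obtain m where m: "m \<in> {a..b}" "\<And>x. x \<in> {a..b} \<Longrightarrow> ?n x \<le> ?n m" by blast
  have mvt: "norm (c x - c a) \<le> K * ?n m * (b - a)"
    if x: "x \<in> {a..b}" and c: "continuous_on {a..b} c"
      and dc: "\<And>x. a < x \<Longrightarrow> x < b \<Longrightarrow> (c has_vector_derivative f x) (at x)"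
      and bc: "\<And>x. a < x \<Longrightarrow> x < b \<Longrightarrow> norm (f x) \<le> K * ?n x"
    for x and c f :: "real \<Rightarrow> complex"
  proof (cases "x = a")
    case True
    then show ?thesis using K(1) assms(1) by (auto intro!: mult_nonneg_nonneg add_nonneg_nonneg)
  next
    case False
    with x have ax: "a < x" "x \<le> b" by auto
    have "\<exists>t\<in>{a<..<x}. norm (c x - c a) \<le> norm ((x - a) *\<^sub>R f t)"
    proof (rule mvt_general[OF ax(1)])
      show "continuous_on {a..x} c" using c ax by (auto intro: continuous_on_subset)
      show "(c has_derivative (\<lambda>h. h *\<^sub>R f t)) (at t)" if "a < t" "t < x" for t
        using dc[of t] that ax by (simp add: has_vector_derivative_def)
    qed
    then obtain t where t: "a < t" "t < x" "norm (c x - c a) \<le> (x - a) * norm (f t)"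
      using ax by auto
    have "norm (f t) \<le> K * ?n m"
      using bc[of t] m(2)[of t] t ax K(1) by (smt (verit) atLeastAtMost_iff mult_left_mono)
    then have "(x - a) * norm (f t) \<le> (b - a) * (K * ?n m)"
      using ax by (intro mult_mono) auto
    then show ?thesis using t by (simp add: mult_ac)
  qed
  have m0: "norm (c0 x - c0 a) \<le> K * ?n m * (b - a)" if "x \<in> {a..b}" for x
    by (rule mvt[OF that assms(2)]) (use d0 b0 in auto)
  have m1: "norm (c1 x - c1 a) \<le> K * ?n m * (b - a)" if "x \<in> {a..b}" for x
    by (rule mvt[OF that assms(3)]) (use d1 b1 in auto)
  have "K * ?n m * (b - a) \<le> ?n m / 4"
    using mult_right_mono[OF K(2), of "?n m"] by (simp add: mult_ac)
  moreover have "?n m \<le> ?n a + norm (c0 m - c0 a) + norm (c1 m - c1 a)"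
    using norm_triangle_sub[of "c0 m" "c0 a"] norm_triangle_sub[of "c1 m" "c1 a"] by linarith
  ultimately have "?n m \<le> 2 * ?n a"
    using m0[OF m(1)] m1[OF m(1)] by argo
  then have "K * ?n m * (b - a) \<le> K * (2 * ?n a) * (b - a)"
    using K(1) assms(1) by (intro mult_right_mono mult_left_mono) auto
  then have le: "K * ?n m * (b - a) \<le> 2 * K * (b - a) * ?n a"
    by (simp only: mult_ac)
  have b: "b \<in> {a..b}" using assms(1) by simp
  show "norm (c0 b - c0 a) \<le> 2 * K * (b - a) * ?n a"
    by (rule order_trans[OF m0[OF b] le])
  show "norm (c1 b - c1 a) \<le> 2 * K * (b - a) * ?n a"
    by (rule order_trans[OF m1[OF b] le])
qed

text \<open>The data at \<open>a\<close> enter through limits of Wronskians, because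
  \<open>a = 0\<close> is a singular point of the system. That \<open>g0\<close> and
  \<open>g1\<close> do not depend on \<open>lam\<close> expresses that all solutions of the family
  start alike.\<close>

lemma parameter_continuity:
  fixes y z :: "complex \<Rightarrow> real \<Rightarrow> complex"
  assumes ab: "0 \<le> a" "a < b"
    and Y0: "system_solution {0<..} tau Y0 Z0"
    and Y1: "system_solution {0<..} tau Y1 Z1"
    and W: "\<And>x. 0 < x \<Longrightarrow> Y0 x * Z1 x - Z0 x * Y1 x = w * of_real x" and w: "w \<noteq> 0"
    and bd: "\<And>x. a < x \<Longrightarrow> x \<le> b \<Longrightarrow> norm (Y0 x) \<le> M" "\<And>x. a < x \<Longrightarrow> x \<le> b \<Longrightarrow> norm (Y1 x) \<le> M"
    and sol: "\<And>lam. system_solution {0<..} lam (y lam) (z lam)"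
    and l0: "\<And>lam. ((\<lambda>x. (y lam x * Z1 x - z lam x * Y1 x) / of_real x) \<longlongrightarrow> g0) (at_right a)"
    and l1: "\<And>lam. ((\<lambda>x. (Y0 x * z lam x - Z0 x * y lam x) / of_real x) \<longlongrightarrow> g1) (at_right a)"
  shows "((\<lambda>lam. y lam b) \<longlongrightarrow> y tau b) (at tau)"
    and "((\<lambda>lam. z lam b) \<longlongrightarrow> z tau b) (at tau)"
proof -
  \<comment> \<open>Up to the factor \<open>w\<close>, these are the coordinates of the solution
    with respect to \<open>(Y0, Z0)\<close> and \<open>(Y1, Z1)\<close> by Cramer's rule, extended
    continuously to \<open>a\<close>.\<close>
  define c0 where "c0 lam x = (if x = a then g0 else (y lam x * Z1 x - z lam x * Y1 x) / of_real x)" for lam x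
  define c1 where "c1 lam x = (if x = a then g1 else (Y0 x * z lam x - Z0 x * y lam x) / of_real x)" for lam x
  have M: "0 \<le> M" using bd(1)[of b] ab norm_ge_zero order_trans by blast
  \<comment> \<open>One factor \<open>M / norm w\<close> bounds \<open>y\<close> by the coordinates;
    the other factor \<open>M\<close> bounds the \<open>Y0\<close> or \<open>Y1\<close> in the
    derivative of a Wronskian.\<close>
  define K where "K = M ^ 2 / norm w"
  have K: "0 \<le> K" by (simp add: K_def)
  have ident: "w * y lam x = Y0 x * c0 lam x + Y1 x * c1 lam x"
      "w * z lam x = Z0 x * c0 lam x + Z1 x * c1 lam x" if "a < x" for lam x
  proof -
    have x: "0 < x" "x \<noteq> a" using that ab by auto
    have n: "y lam x * Z1 x - z lam x * Y1 x = of_real x * c0 lam x"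
        "Y0 x * z lam x - Z0 x * y lam x = of_real x * c1 lam x"
      using x by (simp_all add: c0_def c1_def)
    have "w * of_real x * y lam x = Y0 x * (y lam x * Z1 x - z lam x * Y1 x) + Y1 x * (Y0 x * z lam x - Z0 x * y lam x)"
      "w * of_real x * z lam x = Z0 x * (y lam x * Z1 x - z lam x * Y1 x) + Z1 x * (Y0 x * z lam x - Z0 x * y lam x)"
      unfolding W[OF x(1), symmetric] by (simp_all add: algebra_simps)
    then have "of_real x * (w * y lam x) = of_real x * (Y0 x * c0 lam x + Y1 x * c1 lam x)"
      "of_real x * (w * z lam x) = of_real x * (Z0 x * c0 lam x + Z1 x * c1 lam x)"
      unfolding n by (simp_all add: algebra_simps)
    then show "w * y lam x = Y0 x * c0 lam x + Y1 x * c1 lam x"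
      "w * z lam x = Z0 x * c0 lam x + Z1 x * c1 lam x"
      using x by (simp_all only: mult_cancel_left) auto
  qed
  have y_bound: "norm (y lam x) \<le> M / norm w * (norm (c0 lam x) + norm (c1 lam x))"
    if "a < x" "x \<le> b" for lam x
  proof -
    have "norm w * norm (y lam x) = norm (Y0 x * c0 lam x + Y1 x * c1 lam x)"
      using ident(1)[OF that(1)] by (metis norm_mult)
    also have "\<dots> \<le> norm (Y0 x) * norm (c0 lam x) + norm (Y1 x) * norm (c1 lam x)"
      by (metis norm_mult norm_triangle_ineq)
    also have "\<dots> \<le> M * norm (c0 lam x) + M * norm (c1 lam x)"
      using bd[OF that] by (intro add_mono mult_right_mono) auto
    finally show ?thesis using w by (simp add: field_simps)
  qed
  have D0: "(c0 lam has_vector_derivative (lam - tau) * y lam x * Y1 x) (at x)" if "a < x" for lam x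
  proof (rule has_vector_derivative_transform_within_open)
    show "((\<lambda>x. (y lam x * Z1 x - z lam x * Y1 x) / of_real x) has_vector_derivative
         (lam - tau) * y lam x * Y1 x) (at x)"
      using wronskian_deriv[OF sol Y1, of x] that ab by auto
    show "open {a<..}" by simp
  qed (use that in \<open>auto simp: c0_def\<close>)
  have D1: "(c1 lam has_vector_derivative - ((lam - tau) * y lam x * Y0 x)) (at x)" if "a < x" for lam x
  proof (rule has_vector_derivative_transform_within_open)
    show "((\<lambda>x. - ((y lam x * Z0 x - z lam x * Y0 x) / of_real x)) has_vector_derivative
         - ((lam - tau) * y lam x * Y0 x)) (at x)"
      using wronskian_deriv[OF sol Y0, of x] that ab by (intro has_vector_derivative_minus) auto
    show "open {a<..}" by simp
    show "- ((y lam t * Z0 t - z lam t * Y0 t) / of_real t) = c1 lam t" if "t \<in> {a<..}" for t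
      using that by (simp add: c1_def minus_divide_left mult.commute)
  qed (use that in auto)
  have ext: "continuous_on {a..b} c"
    if "\<And>x. a < x \<Longrightarrow> isCont c x" "(c \<longlongrightarrow> c a) (at_right a)" for c :: "real \<Rightarrow> complex"
    unfolding continuous_on_def
  proof
    fix x assume "x \<in> {a..b}"
    then consider "x = a" | "a < x" by fastforce
    then show "(c \<longlongrightarrow> c x) (at x within {a..b})"
    proof cases
      case 1
      then show ?thesis using that(2) ab by (simp add: at_within_Icc_at_right)
    next
      case 2
      then have "(c \<longlongrightarrow> c x) (at x)" using that(1) isCont_def by blast
      then show ?thesis by (rule tendsto_within_subset) simp
    qed
  qed
  have C0: "continuous_on {a..b} (c0 lam)" for lam
  proof (rule ext)
    show "(c0 lam \<longlongrightarrow> c0 lam a) (at_right a)"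
      using l0[of lam] by (rule tendsto_eq_rhs[OF Lim_transform_eventually])
         (auto simp: c0_def eventually_at_filter)
  qed (rule has_vector_derivative_continuous[OF D0])
  have C1: "continuous_on {a..b} (c1 lam)" for lam
  proof (rule ext)
    show "(c1 lam \<longlongrightarrow> c1 lam a) (at_right a)"
      using l1[of lam] by (rule tendsto_eq_rhs[OF Lim_transform_eventually])
         (auto simp: c1_def eventually_at_filter)
  qed (rule has_vector_derivative_continuous[OF D1])
  have bound: "norm (c0 lam b - g0) \<le> 2 * (norm (lam - tau) * K) * (b - a) * (norm g0 + norm g1) \<and>
      norm (c1 lam b - g1) \<le> 2 * (norm (lam - tau) * K) * (b - a) * (norm g0 + norm g1)"
    if "norm (lam - tau) * K * (b - a) \<le> 1 / 4" for lam
  proof -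
    have bb: "norm (y lam x) * N \<le> K * (norm (c0 lam x) + norm (c1 lam x))"
      if "a < x" "x < b" "N \<le> M" "0 \<le> N" for x N
    proof -
      have "norm (y lam x) * N \<le> M / norm w * (norm (c0 lam x) + norm (c1 lam x)) * M"
        using y_bound[of x lam] that M by (intro mult_mono) auto
      then show ?thesis by (simp add: K_def power2_eq_square mult_ac)
    qed
    have f0: "norm ((lam - tau) * y lam x * Y1 x) \<le> norm (lam - tau) * K * (norm (c0 lam x) + norm (c1 lam x))"
      if "a < x" "x < b" for x
      using mult_left_mono[OF bb[OF that, of "norm (Y1 x)"], of "norm (lam - tau)"] bd(2)[of x] that
      by (simp add: norm_mult mult_ac)
    have f1: "norm (- ((lam - tau) * y lam x * Y0 x)) \<le> norm (lam - tau) * K * (norm (c0 lam x) + norm (c1 lam x))"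
      if "a < x" "x < b" for x
      using mult_left_mono[OF bb[OF that, of "norm (Y0 x)"], of "norm (lam - tau)"] bd(1)[of x] that
      by (simp add: norm_mult mult_ac)
    have ca: "c0 lam a = g0" "c1 lam a = g1" by (simp_all add: c0_def c1_def)
    note pb = perturbation_bound[of a b "c0 lam" "c1 lam" "\<lambda>x. (lam - tau) * y lam x * Y1 x"
        "\<lambda>x. - ((lam - tau) * y lam x * Y0 x)" "norm (lam - tau) * K", unfolded ca]
    show ?thesis
      by (rule conjI; rule pb) (use C0 C1 D0 D1 f0 f1 that K ab in auto)
  qed
  have lim_c: "((\<lambda>lam. c lam b) \<longlongrightarrow> g) (at tau)"
    if "\<And>lam. norm (lam - tau) * K * (b - a) \<le> 1 / 4 \<Longrightarrow>
      norm (c lam b - g) \<le> 2 * (norm (lam - tau) * K) * (b - a) * (norm g0 + norm g1)"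
    for c :: "complex \<Rightarrow> real \<Rightarrow> complex" and g
  proof -
    have "((\<lambda>lam. norm (lam - tau) * K * (b - a)) \<longlongrightarrow> norm (tau - tau) * K * (b - a)) (at tau)"
      by (intro tendsto_intros)
    then have "\<forall>\<^sub>F lam in at tau. norm (lam - tau) * K * (b - a) < 1 / 4"
      by (rule order_tendstoD) auto
    then have ev: "\<forall>\<^sub>F lam in at tau. norm (c lam b - g) \<le> 2 * (norm (lam - tau) * K) * (b - a) * (norm g0 + norm g1)"
      by eventually_elim (rule that, simp)
    have "((\<lambda>lam. 2 * (norm (lam - tau) * K) * (b - a) * (norm g0 + norm g1)) \<longlongrightarrow>
        2 * (norm (tau - tau) * K) * (b - a) * (norm g0 + norm g1)) (at tau)"
      by (intro tendsto_intros)
    then have "((\<lambda>lam. c lam b - g) \<longlongrightarrow> 0) (at tau)"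
      using Lim_null_comparison[OF ev] by simp
    then show ?thesis by (simp add: LIM_zero_iff)
  qed
  have L0: "((\<lambda>lam. c0 lam b) \<longlongrightarrow> g0) (at tau)" and L1: "((\<lambda>lam. c1 lam b) \<longlongrightarrow> g1) (at tau)"
    using bound by (auto intro!: lim_c)
  have T: "c0 tau b = g0" "c1 tau b = g1" using bound[of tau] by auto
  have ys: "y lam b = (Y0 b * c0 lam b + Y1 b * c1 lam b) / w"
      "z lam b = (Z0 b * c0 lam b + Z1 b * c1 lam b) / w" for lam
    using ident[OF ab(2), of lam] w by (simp_all add: field_simps)
  show "((\<lambda>lam. y lam b) \<longlongrightarrow> y tau b) (at tau)" "((\<lambda>lam. z lam b) \<longlongrightarrow> z tau b) (at tau)"
    unfolding ys T by (intro tendsto_intros L0 L1 w)+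
qed

section \<open>The even and the odd solution at the singular point x = 0\<close>

lemma analytic_at_zero_differentiable:
  assumes "analytic_at_zero f"
  obtains D where "(f has_vector_derivative D) (at 0)"
proof -
  obtain g where g: "g analytic_on {0}" "\<forall>\<^sub>F x in nhds 0. f x = g (of_real x)"
    using assms unfolding analytic_at_zero_def by blast
  have "g field_differentiable at (complex_of_real 0)"
    using analytic_on_imp_differentiable_at[OF g(1), of 0] by simp
  then obtain D where "(g has_field_derivative D) (at (complex_of_real 0))"
    unfolding field_differentiable_def by blast
  then have "((\<lambda>x. g (of_real x)) has_vector_derivative D) (at 0)"
    by (rule has_vector_derivative_real_field)
  then have "(f has_vector_derivative D) (at 0)"
    using g(2) by (subst has_vector_derivative_cong_ev[where g = "\<lambda>x. g (of_real x)"])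
      (auto elim: eventually_mono dest: eventually_nhds_x_imp_x)
  then show thesis by (rule that)
qed

lemma even_vector_derivative_zero:
  fixes f :: "real \<Rightarrow> complex"
  assumes "(f has_vector_derivative D) (at 0)" "\<And>x. f (- x) = f x"
  shows "D = 0"
proof -
  have "((f \<circ> uminus) has_vector_derivative (- 1) *\<^sub>R D) (at 0)"
    by (rule vector_diff_chain_at) (use assms(1) in \<open>auto intro!: derivative_eq_intros\<close>)
  moreover have "f \<circ> uminus = f" using assms(2) by auto
  ultimately have "(- 1) *\<^sub>R D = D"
    using assms(1) by (metis vector_derivative_unique_at)
  then show ?thesis by simp
qed

lemma quotient_tendsto_derivative:
  fixes f :: "real \<Rightarrow> complex"
  assumes "(f has_vector_derivative D) (at 0)" "f 0 = 0"
  shows "((\<lambda>x. f x / of_real x) \<longlongrightarrow> D) (at_right 0)"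
proof -
  have lim: "((\<lambda>x. norm (f x - x *\<^sub>R D) / norm x) \<longlongrightarrow> 0) (at 0)"
    using assms unfolding has_vector_derivative_def has_derivative_iff_norm by simp
  have "((\<lambda>x. norm (f x / of_real x - D)) \<longlongrightarrow> 0) (at 0)"
  proof (rule Lim_transform_eventually[OF lim])
    have "norm (f x - x *\<^sub>R D) / norm x = norm (f x / of_real x - D)" if "x \<noteq> 0" for x
    proof -
      have "f x / of_real x - D = (f x - x *\<^sub>R D) / of_real x"
        using that by (simp add: scaleR_conv_of_real diff_divide_distrib)
      then show ?thesis by (simp add: norm_divide)
    qed
    then show "\<forall>\<^sub>F x in at 0. norm (f x - x *\<^sub>R D) / norm x = norm (f x / of_real x - D)"
      by (auto simp: eventually_at_filter)
  qed
  then have "((\<lambda>x. f x / of_real x) \<longlongrightarrow> D) (at 0)"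
    by (rule LIM_zero_cancel[OF tendsto_norm_zero_cancel])
  then show ?thesis by (rule tendsto_within_subset) simp
qed

lemma continuous_on_Icc_norm_bound:
  fixes f :: "real \<Rightarrow> complex"
  assumes "continuous_on {a..b} f"
  obtains M where "\<And>x. x \<in> {a..b} \<Longrightarrow> norm (f x) \<le> M"
proof -
  obtain M where "\<forall>x\<in>{a..b}. norm (f x) \<le> M"
    using compact_imp_bounded[OF compact_continuous_image[OF assms compact_Icc]]
    by (auto simp: bounded_iff)
  then show thesis by (intro that) blast
qed

text \<open>Oddness gives only \<open>z 0 = 0\<close>. The equation z' = x (z - lam y) with a
  bounded second factor then gives |z x| \<le> x^2 M for small positive x, which forces the
  derivative at 0 to vanish.\<close>

lemma odd_solution_derivative_snd:
  assumes "odd_solution lam y z"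
  shows "(z has_vector_derivative 0) (at 0)"
proof -
  have sol: "system_solution (UNIV - {0}) lam y z" and an: "analytic_at_zero y" "analytic_at_zero z"
    and z0: "z 0 = 0"
    using assms unfolding odd_solution_def analytic_solution_def
    by (auto dest: spec[of _ 0])
  obtain Dy Dz where D: "(y has_vector_derivative Dy) (at 0)" "(z has_vector_derivative Dz) (at 0)"
    using an analytic_at_zero_differentiable by metis
  have cont: "continuous_on {0..1} y" "continuous_on {0..1} z"
  proof -
    have "isCont y x \<and> isCont z x" for x
      using D[THEN has_vector_derivative_continuous] system_solution_isCont[OF sol, of x] by (cases "x = 0") auto
    then show "continuous_on {0..1} y" "continuous_on {0..1} z"
      by (auto intro: continuous_at_imp_continuous_on)
  qed
  have "continuous_on {0..1} (\<lambda>x. z x - lam * y x)"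
    by (intro continuous_intros cont)
  then obtain M where M: "\<And>x. x \<in> {0..1} \<Longrightarrow> norm (z x - lam * y x) \<le> M"
    using continuous_on_Icc_norm_bound by blast
  have zb: "norm (z x / of_real x) \<le> x * M" if x: "0 < x" "x < 1" for x
  proof -
    have "\<exists>t\<in>{0<..<x}. norm (z x - z 0) \<le> norm ((x - 0) *\<^sub>R (of_real t * (z t - lam * y t)))"
    proof (rule mvt_general[OF x(1)])
      show "continuous_on {0..x} z" using cont(2) x by (auto intro: continuous_on_subset)
      fix t assume t: "0 < t" "t < x"
      have "(z has_vector_derivative of_real t * (z t - lam * y t)) (at t)"
        using system_solution_iff(2)[OF sol, of t] t by (simp add: algebra_simps)
      then show "(z has_derivative (\<lambda>h. h *\<^sub>R (of_real t * (z t - lam * y t)))) (at t)"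
        by (simp add: has_vector_derivative_def)
    qed
    then obtain t where t: "0 < t" "t < x" "norm (z x) \<le> x * (t * norm (z t - lam * y t))"
      using x z0 by (auto simp: norm_mult)
    have "t * norm (z t - lam * y t) \<le> x * M"
      using t x M[of t] by (intro mult_mono) auto
    then have "norm (z x) \<le> x * (x * M)"
      using t(3) x mult_left_mono[of _ _ x] by (meson less_imp_le order_trans)
    then show ?thesis using x by (simp add: norm_divide field_simps)
  qed
  have "((\<lambda>x. z x / of_real x) \<longlongrightarrow> 0) (at_right 0)"
  proof (rule Lim_null_comparison)
    show "\<forall>\<^sub>F x in at_right 0. norm (z x / of_real x) \<le> x * M"
      using eventually_at_right_less[of 0] eventually_at_right_real[of 0 1]
      by (auto elim: eventually_mono intro: zb)
    show "((\<lambda>x. x * M) \<longlongrightarrow> 0) (at_right 0)"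
      by (auto intro!: tendsto_eq_intros)
  qed
  then have "Dz = 0"
    using quotient_tendsto_derivative[OF D(2) z0] tendsto_unique trivial_limit_at_right_real by blast
  then show ?thesis using D(2) by simp
qed

lemma even_solution_derivatives:
  assumes "even_solution lam y z"
  shows "(y has_vector_derivative 0) (at 0)" "(z has_vector_derivative 0) (at 0)"
proof -
  have "analytic_at_zero y" "analytic_at_zero z" "\<And>x. y (- x) = y x" "\<And>x. z (- x) = z x"
    using assms unfolding even_solution_def analytic_solution_def by auto
  then obtain Dy Dz where D: "(y has_vector_derivative Dy) (at 0)" "(z has_vector_derivative Dz) (at 0)"
    and even: "\<And>x. y (- x) = y x" "\<And>x. z (- x) = z x"
    by (meson analytic_at_zero_differentiable)
  show "(y has_vector_derivative 0) (at 0)" "(z has_vector_derivative 0) (at 0)"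
    using D even_vector_derivative_zero[OF D(1) even(1)] even_vector_derivative_zero[OF D(2) even(2)]
    by auto
qed

lemma even_odd_initial:
  "even_solution lam y z \<Longrightarrow> system_solution {0<..} lam y z \<and> z 0 = - 1"
  "odd_solution lam y z \<Longrightarrow> system_solution {0<..} lam y z \<and> y 0 = 0 \<and> z 0 = 0"
  unfolding even_solution_def odd_solution_def analytic_solution_def
  by (auto intro: system_solution_subset dest: spec[of _ 0])

text \<open>Each Wronskian vanishes at 0, so its quotient by \<open>x\<close> tends to its
  derivative there. In the product rule all terms vanish except the product of the value -1 of the
  even second component and the derivative 1 of the odd first component. The limits are the same for
  all pairs of parameters.\<close>

lemma at_zero_limits:
  assumes e: "even_solution lam y0 z0" and e': "even_solution lam' y0' z0'"
    and o: "odd_solution lam y1 z1" and o': "odd_solution lam' y1' z1'"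
  shows "((\<lambda>x. (y0 x * z1' x - z0 x * y1' x) / of_real x) \<longlongrightarrow> 1) (at_right 0)"
    and "((\<lambda>x. (y0' x * z0 x - z0' x * y0 x) / of_real x) \<longlongrightarrow> 0) (at_right 0)"
    and "((\<lambda>x. (y1 x * z1' x - z1 x * y1' x) / of_real x) \<longlongrightarrow> 0) (at_right 0)"
    and "((\<lambda>x. (y0' x * z1 x - z0' x * y1 x) / of_real x) \<longlongrightarrow> 1) (at_right 0)"
proof -
  note ini = even_odd_initial(1)[OF e] even_odd_initial(1)[OF e']
      even_odd_initial(2)[OF o] even_odd_initial(2)[OF o']
  have y00: "y0 0 = y0' 0" using e e' unfolding even_solution_def by (elim conjE) (simp only:)
  have dy: "(y1 has_vector_derivative 1) (at 0)" "(y1' has_vector_derivative 1) (at 0)"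
    using o o' by (auto simp: odd_solution_def)
  note d = even_solution_derivatives[OF e] even_solution_derivatives[OF e'] dy
    odd_solution_derivative_snd[OF o] odd_solution_derivative_snd[OF o']
  have D: "((\<lambda>x. (f x * h x - g x * k x) / of_real x) \<longlongrightarrow> L) (at_right 0)"
    if "(f has_vector_derivative f') (at 0)" "(g has_vector_derivative g') (at 0)"
      "(h has_vector_derivative h') (at 0)" "(k has_vector_derivative k') (at 0)"
      "f 0 * h 0 = g 0 * k 0" "L = f 0 * h' + f' * h 0 - (g 0 * k' + g' * k 0)"
    for f g h k :: "real \<Rightarrow> complex" and f' g' h' k' L
    unfolding that(6)
    by (rule quotient_tendsto_derivative) (use that(1-5) in \<open>auto intro!: derivative_intros\<close>)
  show "((\<lambda>x. (y0 x * z1' x - z0 x * y1' x) / of_real x) \<longlongrightarrow> 1) (at_right 0)"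
    by (rule D[OF d(1) d(2) d(8) d(6)]) (use ini in auto)
  show "((\<lambda>x. (y0' x * z0 x - z0' x * y0 x) / of_real x) \<longlongrightarrow> 0) (at_right 0)"
    by (rule D[OF d(3) d(4) d(2) d(1)]) (use ini y00 in auto)
  show "((\<lambda>x. (y1 x * z1' x - z1 x * y1' x) / of_real x) \<longlongrightarrow> 0) (at_right 0)"
    by (rule D[OF d(5) d(7) d(8) d(6)]) (use ini in auto)
  show "((\<lambda>x. (y0' x * z1 x - z0' x * y1 x) / of_real x) \<longlongrightarrow> 1) (at_right 0)"
    by (rule D[OF d(3) d(4) d(7) d(5)]) (use ini in auto)
qed

text \<open>The Wronskian divided by \<open>x\<close> is constant, and its limit at 0 is 1.\<close>

lemma even_odd_det:
  assumes e: "even_solution lam y0 z0" and o: "odd_solution lam y1 z1" and x: "0 < x"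
  shows "y0 x * z1 x - z0 x * y1 x = of_real x"
proof -
  let ?W = "\<lambda>x. (y0 x * z1 x - z0 x * y1 x) / of_real x"
  have "\<forall>\<^sub>F t in at_right 0. ?W t = ?W x"
    using eventually_at_right_less[of 0]
    by eventually_elim
      (rule wronskian_const[OF even_odd_initial(1)[OF e, THEN conjunct1] even_odd_initial(2)[OF o, THEN conjunct1] _ x])
  then have "(?W \<longlongrightarrow> ?W x) (at_right 0)"
    by (rule tendsto_eventually)
  then have "?W x = 1"
    using at_zero_limits(1)[OF e e o o] tendsto_unique trivial_limit_at_right_real by blast
  then show ?thesis using x by simp
qed

lemma even_odd_parameter_continuity:
  assumes e: "\<And>lam. even_solution lam (y0 lam) (z0 lam)"
    and o: "\<And>lam. odd_solution lam (y1 lam) (z1 lam)" and b: "0 < b"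
  shows "((\<lambda>lam. y0 lam b) \<longlongrightarrow> y0 tau b) (at tau)" "((\<lambda>lam. z0 lam b) \<longlongrightarrow> z0 tau b) (at tau)"
    "((\<lambda>lam. y1 lam b) \<longlongrightarrow> y1 tau b) (at tau)" "((\<lambda>lam. z1 lam b) \<longlongrightarrow> z1 tau b) (at tau)"
proof -
  have se: "system_solution {0<..} lam (y0 lam) (z0 lam)" and so: "system_solution {0<..} lam (y1 lam) (z1 lam)" for lam
    using even_odd_initial(1)[OF e] even_odd_initial(2)[OF o] by simp_all
  have W: "y0 tau x * z1 tau x - z0 tau x * y1 tau x = 1 * of_real x" if "0 < x" for x
    using even_odd_det[OF e o that] by simp
  have cont: "continuous_on {0..b} f"
    if c: "\<And>x. 0 < x \<Longrightarrow> isCont f x" and d: "(f has_vector_derivative D) (at 0)"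
    for f :: "real \<Rightarrow> complex" and D
  proof (intro continuous_at_imp_continuous_on ballI)
    fix x assume "x \<in> {0..b}"
    then show "isCont f x"
      using c has_vector_derivative_continuous[OF d] by (cases "x = 0") auto
  qed
  have "continuous_on {0..b} (y0 tau)"
    by (rule cont[OF _ even_solution_derivatives(1)[OF e]]) (auto intro: system_solution_isCont[OF se])
  then obtain M0 where M0: "\<And>x. x \<in> {0..b} \<Longrightarrow> norm (y0 tau x) \<le> M0"
    using continuous_on_Icc_norm_bound by blast
  have "(y1 tau has_vector_derivative 1) (at 0)" using o by (auto simp: odd_solution_def)
  then have "continuous_on {0..b} (y1 tau)"
    by (rule cont[rotated]) (auto intro: system_solution_isCont[OF so])
  then obtain M1 where M1: "\<And>x. x \<in> {0..b} \<Longrightarrow> norm (y1 tau x) \<le> M1"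
    using continuous_on_Icc_norm_bound by blast
  have M: "norm (y0 tau x) \<le> max M0 M1" "norm (y1 tau x) \<le> max M0 M1" if "0 < x" "x \<le> b" for x
    using M0[of x] M1[of x] that by auto
  note pc = parameter_continuity[OF order_refl b se so W _ M]
  show "((\<lambda>lam. y0 lam b) \<longlongrightarrow> y0 tau b) (at tau)" "((\<lambda>lam. z0 lam b) \<longlongrightarrow> z0 tau b) (at tau)"
    by (rule pc[where y = y0 and z = z0];
        (rule se at_zero_limits(1)[OF e e o o] at_zero_limits(2)[OF e e o o] | simp))+
  show "((\<lambda>lam. y1 lam b) \<longlongrightarrow> y1 tau b) (at tau)" "((\<lambda>lam. z1 lam b) \<longlongrightarrow> z1 tau b) (at tau)"
    by (rule pc[where y = y1 and z = z1];
        (rule so at_zero_limits(3)[OF e e o o] at_zero_limits(4)[OF e e o o] | simp))+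
qed

section \<open>The approximate Riccati solution\<close>

text \<open>The quotient r = y / z of a solution satisfies r' = p + r/x - 2 x r + lam x r^2 with p =
  \<open>pcoef x\<close>. The right-hand side of the identity is thus the residual of the
  approximate solution, for P = \<open>pcoef x\<close>, c = 2 / Einf and L = lam. The relation for
  \<open>S ^ 2\<close> removes the leading order.\<close>

lemma riccati_identity:
  fixes x S L c P :: complex
  assumes "x \<noteq> 0" "S \<noteq> 0" "L \<noteq> 0" and S: "S ^ 2 = c * x * L - 1"
    and r: "r = (1 - \<i> * S - 1 / (4 * x ^ 2)) / L"
    and r': "r' = (1 / (2 * x ^ 3) - \<i> * (c * L / (2 * S))) / L"
  shows "P + r / x - 2 * x * r + L * x * r ^ 2 - r'
    = (P - c * x ^ 2) + \<i> / (2 * L * x * S) + 1 / (L * x) - 11 / (16 * L * x ^ 3)"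
proof -
  \<comment> \<open>With the inverses as variables of their own, the identity becomes polynomial
    modulo \<open>x * u ^ 2 = u\<close> and the relation for \<open>S ^ 2\<close>.\<close>
  define u v l where uvl: "u = 1 / x" "v = 1 / S" "l = 1 / L"
  define a where "a = 1 - \<i> * S - u ^ 2 / 4"
  have xu: "x * u ^ 2 = u" "x * u ^ 4 = u ^ 3"
    using assms(1) by (simp_all add: uvl field_simps eval_nat_numeral)
  have u2: "1 / (4 * x ^ 2) = u ^ 2 / 4" and u3: "1 / (2 * x ^ 3) = u ^ 3 / 2"
    by (simp_all add: uvl power_one_over)
  have ra: "r = l * a"
    unfolding r u2 by (simp add: a_def uvl)
  have lr2: "L * x * r ^ 2 = l * (x * a ^ 2)"
    using assms(3) by (simp add: ra uvl power2_eq_square)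
  have S1: "c * x * L = S ^ 2 + 1" using S by simp
  have "c * x ^ 2 = l * (x * (c * x * L))"
    using assms(3) by (simp add: uvl power2_eq_square)
  then have cx2: "c * x ^ 2 = l * (x * (S ^ 2 + 1))" unfolding S1 .
  have "c * L / (2 * S) = u * (c * x * L) * v / 2"
    using assms(1) by (simp add: uvl)
  also have "\<dots> = u * (S ^ 2 + 1) * v / 2" unfolding S1 ..
  also have "\<dots> = u * (S + v) / 2"
    using assms(2) by (simp add: uvl field_simps power2_eq_square)
  finally have cL: "c * L / (2 * S) = u * (S + v) / 2" .
  have r'': "r' = l * (u ^ 3 / 2 - \<i> * (u * (S + v) / 2))"
    unfolding r' u3 cL by (simp add: uvl)
  have a2: "a ^ 2 - 2 * a = - (S ^ 2 + 1) + \<i> * S * u ^ 2 / 2 + u ^ 4 / 16"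
    by (simp add: a_def power2_eq_square field_simps eval_nat_numeral)
  have "x * a ^ 2 - 2 * x * a = x * (a ^ 2 - 2 * a)"
    by (simp add: algebra_simps)
  also note a2
  also have "x * (- (S ^ 2 + 1) + \<i> * S * u ^ 2 / 2 + u ^ 4 / 16)
      = - x * (S ^ 2 + 1) + \<i> * S * (x * u ^ 2) / 2 + x * u ^ 4 / 16"
    by (simp add: algebra_simps)
  finally have xa2: "x * a ^ 2 - 2 * x * a = - x * (S ^ 2 + 1) + \<i> * S * u / 2 + u ^ 3 / 16"
    by (simp only: xu)
  have "P + r * u - 2 * x * r + L * x * r ^ 2 - r'
      = P + l * (a * u + (x * a ^ 2 - 2 * x * a) - (u ^ 3 / 2 - \<i> * (u * (S + v) / 2)))"
    unfolding lr2 r'' by (simp add: ra algebra_simps)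
  also have "\<dots> = (P - c * x ^ 2) + l * (\<i> * u * v / 2 + u - 11 * u ^ 3 / 16)"
    unfolding xa2 cx2 unfolding a_def by (simp add: field_simps power2_eq_square power3_eq_cube)
  also have "l * (\<i> * u * v / 2 + u - 11 * u ^ 3 / 16)
      = \<i> / (2 * L * x * S) + 1 / (L * x) - 11 / (16 * L * x ^ 3)"
    using assms(1-3) by (simp add: uvl power_one_over distrib_left right_diff_distrib mult_ac)
  finally show ?thesis by (simp add: uvl)
qed

text \<open>With \<open>p\<close> replaced by its leading term \<open>2x\<^sup>2 / Einf\<close>, the root of the quadratic
  \<open>p - 2xr + \<lambda>xr\<^sup>2\<close> in the lower half-plane is \<open>(1 - \<i>S) / \<lambda>\<close> with \<open>S\<^sup>2 = 2x\<lambda> / Einf - 1\<close>; the term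
  \<open>- 1 / (4x\<^sup>2)\<close> cancels the part of the defect of order \<open>x\<^bsup>-1/2\<^esup>\<close>, which would not be
  integrable relative to \<open>Im r\<close>.\<close>

definition wkb_root :: "complex \<Rightarrow> real \<Rightarrow> complex" where
  "wkb_root lam x = csqrt (of_real (2 / Einf) * of_real x * lam - 1)"

definition wkb_ratio :: "complex \<Rightarrow> real \<Rightarrow> complex" where
  "wkb_ratio lam x = (1 - \<i> * wkb_root lam x - 1 / (4 * of_real x ^ 2)) / lam"

definition wkb_defect :: "complex \<Rightarrow> real \<Rightarrow> complex" where
  "wkb_defect lam x = (of_real (pcoef x) - of_real (2 / Einf) * of_real x ^ 2)
     + \<i> / (2 * lam * of_real x * wkb_root lam x) + 1 / (lam * of_real x) - 11 / (16 * lam * of_real x ^ 3)"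

text \<open>Constants in the bounds for \<open>wkb_ratio\<close>, of order sqrt x, and for
  \<open>wkb_defect\<close>, of order 1/x. They depend on \<open>tau\<close> alone, which makes the
  estimates uniform in Im lam.\<close>

definition ratio_lower :: "real \<Rightarrow> real" where
  "ratio_lower tau = sqrt (tau / Einf) / (2 * tau)"

definition ratio_upper :: "real \<Rightarrow> real" where
  "ratio_upper tau = (2 + sqrt (5 * tau / Einf)) / tau"

definition defect_upper :: "real \<Rightarrow> real" where
  "defect_upper tau = 72 / (Eaux 1 * Einf) + 3 / tau"

text \<open>The real axis is included because boundary values are wanted there; the upper bound on
  \<open>Im lam\<close> makes \<open>norm lam\<close> comparable with \<open>tau\<close>.\<close>

locale half_strip =
  fixes tau :: real and lam :: complex
  assumes tau: "0 < tau" and Re_lam: "Re lam = tau" and Im_lam: "0 \<le> Im lam" "Im lam \<le> tau"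
begin

lemma norm_lam: "tau \<le> norm lam" "norm lam ^ 2 \<le> 2 * tau ^ 2" "norm lam \<le> 2 * tau" "lam \<noteq> 0"
proof -
  show "tau \<le> norm lam" using complex_Re_le_cmod[of lam] Re_lam by simp
  show "norm lam ^ 2 \<le> 2 * tau ^ 2"
    using power_mono[OF Im_lam(2,1), of 2] by (simp add: cmod_power2 Re_lam)
  show "norm lam \<le> 2 * tau"
    using cmod_le[of lam] Re_lam Im_lam tau by simp
  show "lam \<noteq> 0" using tau Re_lam by auto
qed

context
  fixes x :: real
  assumes x: "1 \<le> x" "Einf / tau \<le> x"
begin

text \<open>From \<open>Einf / tau\<close> on, the radicand of \<open>wkb_root\<close> therefore has
  real part at least 1 and stays away from the branch cut.\<close>

lemma wkb_large: "1 \<le> tau / Einf * x"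
  using x(2) tau Einf_pos by (simp add: field_simps)

lemma wkb_root_square: "wkb_root lam x ^ 2 = of_real (2 / Einf) * of_real x * lam - 1"
  by (simp add: wkb_root_def)

lemma wkb_radicand:
  "Re (of_real (2 / Einf) * of_real x * lam - 1) = 2 * (tau / Einf * x) - 1"
  "Im (of_real (2 / Einf) * of_real x * lam - 1) = 2 / Einf * x * Im lam"
  by (simp_all add: Re_lam mult_ac)

text \<open>Compare real and imaginary parts in the equation for S^2: the first gives (Re S)^2 \<ge>
  tau x / Einf, and 2 Re S Im S has the sign of Im lam. The sign of Im S matters because x Im S
  enters the growth rate of the denominator.\<close>

lemma wkb_root_bounds:
  "sqrt (tau / Einf) * sqrt x \<le> Re (wkb_root lam x)"
  "0 \<le> Im (wkb_root lam x)"
  "Im lam = 0 \<Longrightarrow> Im (wkb_root lam x) = 0"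
  "norm (wkb_root lam x) \<le> sqrt (5 * tau / Einf) * sqrt x"
  "1 \<le> norm (wkb_root lam x)"
  "wkb_root lam x \<noteq> 0"
proof -
  let ?S = "wkb_root lam x" and ?a = "tau / Einf * x"
  have re: "Re ?S ^ 2 - Im ?S ^ 2 = 2 * ?a - 1"
    using arg_cong[OF wkb_root_square, of Re] unfolding wkb_radicand by (simp add: power2_eq_square)
  have im: "2 * Re ?S * Im ?S = 2 / Einf * x * Im lam"
    using arg_cong[OF wkb_root_square, of Im] unfolding wkb_radicand by (simp add: power2_eq_square mult_ac)
  have Re0: "0 \<le> Re ?S" using csqrt_principal[of "of_real (2 / Einf) * of_real x * lam - 1"]
    unfolding wkb_root_def by auto
  have sq: "?a \<le> Re ?S ^ 2"
    using re wkb_large zero_le_power2[of "Im ?S"] by linarith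
  have "sqrt ?a \<le> Re ?S"
    by (rule real_le_lsqrt[OF Re0 sq])
  then show R: "sqrt (tau / Einf) * sqrt x \<le> Re ?S"
    by (simp add: real_sqrt_mult[symmetric])
  have one: "1 \<le> sqrt ?a" using wkb_large by simp
  with \<open>sqrt ?a \<le> Re ?S\<close> have Re1: "1 \<le> Re ?S" by linarith
  have "0 \<le> 2 * Re ?S * Im ?S"
    unfolding im using Im_lam Einf_pos x by simp
  then show "0 \<le> Im ?S" using Re1 by (simp add: zero_le_mult_iff)
  show "Im ?S = 0" if "Im lam = 0" using im that Re1 by simp
  show N: "1 \<le> norm ?S" using Re1 complex_Re_le_cmod[of ?S] by linarith
  then show "?S \<noteq> 0" by auto
  have "norm ?S ^ 2 = norm (of_real (2 / Einf) * of_real x * lam - 1)"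
    using wkb_root_square by (metis norm_power)
  also have "\<dots> \<le> norm (of_real (2 / Einf) * of_real x * lam) + 1"
    using norm_triangle_ineq4[of "of_real (2 / Einf) * of_real x * lam" 1] by simp
  also have "norm (of_real (2 / Einf) * of_real x * lam) = 2 / Einf * x * norm lam"
    using x Einf_pos by (simp add: norm_mult norm_divide)
  also have "\<dots> \<le> 2 / Einf * x * (2 * tau)"
    using norm_lam x Einf_pos by (intro mult_left_mono) auto
  also have "\<dots> = 4 * ?a" by simp
  finally have "norm ?S ^ 2 \<le> 5 * ?a" using wkb_large by linarith
  then have "norm ?S \<le> sqrt (5 * ?a)" by (rule real_le_rsqrt)
  also have "5 * ?a = 5 * tau / Einf * x" by simp
  finally show "norm ?S \<le> sqrt (5 * tau / Einf) * sqrt x"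
    by (simp only: real_sqrt_mult)
qed

lemma wkb_root_deriv:
  "(wkb_root lam has_vector_derivative of_real (2 / Einf) * lam / (2 * wkb_root lam x)) (at x)"
proof -
  have "of_real (2 / Einf) * of_real x * lam - 1 \<notin> \<real>\<^sub>\<le>\<^sub>0"
    using wkb_radicand(1) wkb_large by (simp only: complex_nonpos_Reals_iff) linarith
  then have "((\<lambda>t. csqrt (of_real (2 / Einf) * t * lam - 1)) has_field_derivative
      of_real (2 / Einf) * lam / (2 * csqrt (of_real (2 / Einf) * of_real x * lam - 1))) (at (of_real x))"
    by (intro has_field_derivative_csqrt') (auto intro!: derivative_eq_intros)
  from has_vector_derivative_real_field[OF this] show ?thesis
    unfolding wkb_root_def [abs_def] .
qed

lemma wkb_ratio_deriv:
  "(wkb_ratio lam has_vector_derivative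
     (1 / (2 * of_real x ^ 3) - \<i> * (of_real (2 / Einf) * lam / (2 * wkb_root lam x))) / lam) (at x)"
proof -
  have "((\<lambda>t::complex. 1 / (4 * t ^ 2)) has_field_derivative - 1 / (2 * of_real x ^ 3)) (at (of_real x))"
    using x by (auto intro!: derivative_eq_intros simp: field_simps eval_nat_numeral)
  from has_vector_derivative_real_field[OF this]
  have d: "((\<lambda>t. 1 / (4 * complex_of_real t ^ 2)) has_vector_derivative - 1 / (2 * of_real x ^ 3)) (at x)" .
  have "((\<lambda>t. (1 - \<i> * wkb_root lam t - 1 / (4 * of_real t ^ 2)) * (1 / lam)) has_vector_derivative
      (0 - \<i> * (of_real (2 / Einf) * lam / (2 * wkb_root lam x)) - (- 1 / (2 * of_real x ^ 3))) * (1 / lam)) (at x)"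
    by (intro has_vector_derivative_mult_left has_vector_derivative_diff has_vector_derivative_mult_right
        has_vector_derivative_const wkb_root_deriv d)
  then show ?thesis
    unfolding wkb_ratio_def [abs_def] by simp
qed

text \<open>After multiplication by \<open>cnj lam\<close>, all summands of -Im r are nonnegative,
  and Re S contributes the order sqrt x.\<close>

lemma wkb_ratio_bounds:
  "ratio_lower tau * sqrt x \<le> - Im (wkb_ratio lam x)"
  "norm (wkb_ratio lam x) \<le> ratio_upper tau * sqrt x"
proof -
  let ?S = "wkb_root lam x" and ?t = "1 - 1 / (4 * x ^ 2)"
  have x2: "1 \<le> x ^ 2" using x by simp
  have t: "0 \<le> ?t" "1 / (4 * x ^ 2) \<le> 1" "0 \<le> 1 / (4 * x ^ 2)" using x2 by (auto simp: divide_simps)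
  have ratio: "wkb_ratio lam x = (of_real ?t - \<i> * ?S) / lam"
    by (simp add: wkb_ratio_def algebra_simps)
  have "- Im (wkb_ratio lam x) = (?t * Im lam + (Re ?S * tau + Im ?S * Im lam)) / norm lam ^ 2"
    unfolding ratio by (simp add: Im_divide cmod_power2 Re_lam minus_divide_left algebra_simps)
  also have "\<dots> \<ge> (Re ?S * tau) / (2 * tau ^ 2)"
  proof (rule frac_le)
    show "Re ?S * tau \<le> ?t * Im lam + (Re ?S * tau + Im ?S * Im lam)"
      using t(1) Im_lam wkb_root_bounds(2) by (simp add: mult_nonneg_nonneg)
    show "0 \<le> ?t * Im lam + (Re ?S * tau + Im ?S * Im lam)"
      using t(1) Im_lam wkb_root_bounds(2) wkb_root_bounds(1) tau x Einf_pos
      by (intro add_nonneg_nonneg mult_nonneg_nonneg) (auto intro: order_trans[rotated])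
  qed (use norm_lam in auto)
  also have "(Re ?S * tau) / (2 * tau ^ 2) = Re ?S / (2 * tau)"
    using tau by (simp add: power2_eq_square)
  also have "\<dots> \<ge> sqrt (tau / Einf) * sqrt x / (2 * tau)"
    using wkb_root_bounds(1) tau by (intro divide_right_mono) auto
  finally show "ratio_lower tau * sqrt x \<le> - Im (wkb_ratio lam x)"
    by (simp add: ratio_lower_def)
  have sx: "1 \<le> sqrt x" using x by simp
  have "norm (of_real ?t - \<i> * ?S) \<le> norm (complex_of_real ?t) + norm (\<i> * ?S)"
    by (rule norm_triangle_ineq4)
  also have "\<dots> \<le> 2 * sqrt x + sqrt (5 * tau / Einf) * sqrt x"
  proof (rule add_mono)
    show "norm (complex_of_real ?t) \<le> 2 * sqrt x" unfolding norm_of_real using t sx by linarith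
    show "norm (\<i> * ?S) \<le> sqrt (5 * tau / Einf) * sqrt x" using wkb_root_bounds(4) by (simp add: norm_mult)
  qed
  finally have "norm (wkb_ratio lam x) \<le> (2 * sqrt x + sqrt (5 * tau / Einf) * sqrt x) / tau"
    unfolding ratio norm_divide using norm_lam tau
    by (intro frac_le order_trans[OF norm_ge_zero]) auto
  then show "norm (wkb_ratio lam x) \<le> ratio_upper tau * sqrt x"
    by (simp add: ratio_upper_def algebra_simps)
qed

text \<open>The first term is controlled by \<open>pcoef_upper\<close>; each of the other three is
  at most 1 / (tau x), whence the summand \<open>3 / tau\<close> in
  \<open>defect_upper\<close>.\<close>

lemma wkb_defect_bound: "norm (wkb_defect lam x) \<le> defect_upper tau / x"
proof -
  let ?S = "wkb_root lam x"
  have x0: "0 < x" using x by simp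
  have "norm (of_real (pcoef x) - of_real (2 / Einf) * of_real x ^ 2 :: complex)
      = \<bar>pcoef x - 2 / Einf * x ^ 2\<bar>"
    by (metis norm_of_real of_real_diff of_real_mult of_real_power)
  also have "\<dots> \<le> 72 / (Eaux 1 * Einf) / x"
    using pcoef_lower[OF x0] pcoef_upper[OF x(1)] by linarith
  finally have 1: "norm (of_real (pcoef x) - of_real (2 / Einf) * of_real x ^ 2 :: complex)
      \<le> 72 / (Eaux 1 * Einf) / x" .
  have 2: "norm (\<i> / (2 * lam * of_real x * ?S)) \<le> 1 / (tau * x)"
  proof -
    have "tau * x \<le> 2 * norm lam * x * norm ?S"
    proof -
      have "tau * x * 1 \<le> (2 * norm lam * x) * norm ?S"
        using norm_lam x0 tau wkb_root_bounds(5) by (intro mult_mono) auto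
      then show ?thesis by simp
    qed
    then show ?thesis
      using x0 tau by (simp add: norm_divide norm_mult) (intro frac_le; simp)
  qed
  have 3: "norm (1 / (lam * of_real x)) \<le> 1 / (tau * x)"
    using x0 tau norm_lam(1) by (simp add: norm_divide norm_mult) (intro frac_le mult_right_mono; simp)
  have 4: "norm (11 / (16 * lam * of_real x ^ 3)) \<le> 1 / (tau * x)"
  proof -
    have "x * 1 \<le> x * x ^ 2" using x0 x by (intro mult_left_mono) auto
    then have "x \<le> x ^ 3" by (simp add: eval_nat_numeral)
    then have "tau * x \<le> norm lam * x ^ 3" using norm_lam tau x0 by (intro mult_mono) auto
    moreover have "0 < tau * x" using tau x0 by simp
    ultimately have "11 / (16 * (norm lam * x ^ 3)) \<le> 11 / (16 * (tau * x))"
      by (intro frac_le) auto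
    also have "\<dots> \<le> 1 / (tau * x)" using tau x0 by (simp add: field_simps)
    finally show ?thesis using x0 by (simp add: norm_divide norm_mult norm_power mult_ac)
  qed
  have "norm (wkb_defect lam x) \<le> 72 / (Eaux 1 * Einf) / x + 1 / (tau * x) + 1 / (tau * x) + 1 / (tau * x)"
    unfolding wkb_defect_def
    by (intro order_trans[OF norm_triangle_ineq4] add_mono order_trans[OF norm_triangle_ineq] 1 2 3 4)
  also have "\<dots> = defect_upper tau / x"
    using x0 tau by (simp add: defect_upper_def field_simps)
  finally show ?thesis .
qed

text \<open>For an exact Riccati solution r, the combination y - r z would satisfy a scalar linear
  equation; the defect is the only coupling to z. The coefficient 1/x - x + lam x r equals 3/(4x) -
  \<i> x S, and 3/(4x) is the source of the growth x^(3/4).\<close>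

lemma wkb_deriv:
  assumes sol: "system_solution {0<..} lam y z"
  shows "((\<lambda>x. y x - wkb_ratio lam x * z x) has_vector_derivative
     (of_real (3 / (4 * x)) - \<i> * of_real x * wkb_root lam x) * (y x - wkb_ratio lam x * z x)
     + wkb_defect lam x * z x) (at x)"
proof -
  let ?S = "wkb_root lam x" and ?r = "wkb_ratio lam x"
  let ?r' = "(1 / (2 * of_real x ^ 3) - \<i> * (of_real (2 / Einf) * lam / (2 * ?S))) / lam"
  let ?K = "of_real (3 / (4 * x)) - \<i> * of_real x * ?S"
  have x0: "0 < x" "complex_of_real x \<noteq> 0" using x by auto
  note d = system_solution_iff[OF sol _ x0(1)]
  have D: "((\<lambda>x. y x - wkb_ratio lam x * z x) has_vector_derivative
      (of_real (1 / x - x) * y x + of_real (pcoef x) * z x)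
      - (?r * (of_real x * z x - lam * of_real x * y x) + ?r' * z x)) (at x)"
    by (intro has_vector_derivative_diff has_vector_derivative_mult d wkb_ratio_deriv) (use x0 in auto)
  have ric: "of_real (pcoef x) + ?r / of_real x - 2 * of_real x * ?r + lam * of_real x * ?r ^ 2 - ?r'
      = wkb_defect lam x"
    unfolding wkb_defect_def
    by (rule riccati_identity[OF x0(2) wkb_root_bounds(6) norm_lam(4) wkb_root_square])
       (simp_all add: wkb_ratio_def)
  have K: "?K = 1 / of_real x - of_real x + lam * of_real x * ?r"
    using x0 norm_lam(4) by (simp add: wkb_ratio_def field_simps power2_eq_square)
  have "(of_real (1 / x - x) * y x + of_real (pcoef x) * z x)
      - (?r * (of_real x * z x - lam * of_real x * y x) + ?r' * z x)
      = ?K * (y x - ?r * z x) + wkb_defect lam x * z x"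
    unfolding K ric[symmetric] by (simp add: algebra_simps power2_eq_square)
  with D show ?thesis by simp
qed

end

end

section \<open>Weyl approximants\<close>

lemma has_real_derivative_norm_square:
  fixes f :: "real \<Rightarrow> complex"
  assumes "(f has_vector_derivative f') (at x)"
  shows "((\<lambda>x. norm (f x) ^ 2) has_real_derivative 2 * Re (cnj (f x) * f')) (at x)"
  unfolding cmod_power2
  by (auto intro!: derivative_eq_intros assms)

text \<open>The integrating factor for F' = (3/(2x) - 2G/(x sqrt x)) F. The exponential tends to 1,
  so the weight is x^(-3/2) up to a bounded factor.\<close>

definition growth_weight :: "real \<Rightarrow> real \<Rightarrow> real" where
  "growth_weight G x = exp (- (4 * G) / sqrt x) / (x * sqrt x)"

lemma growth_weight_pos: "0 < x \<Longrightarrow> 0 < growth_weight G x"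
  by (simp add: growth_weight_def)

lemma growth_weight_deriv:
  assumes "0 < x"
  shows "(growth_weight G has_real_derivative
           growth_weight G x * (2 * G / (x * sqrt x) - 3 / (2 * x))) (at x)"
proof -
  define s where "s = sqrt x"
  have s: "0 < s" "x = s * s" using assms by (simp_all add: s_def)
  have d: "(sqrt has_real_derivative 1 / (2 * s)) (at x)"
    using DERIV_real_sqrt[OF assms] by (simp add: s_def field_simps)
  note d1 = DERIV_divide[OF DERIV_const[of "- (4 * G)"] d]
  have "((\<lambda>t. exp (- (4 * G) / sqrt t)) has_real_derivative
      exp (- (4 * G) / s) * ((0 * s - (- (4 * G)) * (1 / (2 * s))) / (s * s))) (at x)"
    using DERIV_fun_exp[OF d1] s(1) unfolding s_def[symmetric] by simp
  moreover have "((\<lambda>t. t * sqrt t) has_real_derivative 1 * s + 1 / (2 * s) * x) (at x)"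
    using DERIV_mult[OF DERIV_ident d] unfolding s_def[symmetric] .
  ultimately have D: "(growth_weight G has_real_derivative
      (exp (- (4 * G) / s) * ((0 * s - (- (4 * G)) * (1 / (2 * s))) / (s * s)) * (x * s)
        - exp (- (4 * G) / s) * (1 * s + 1 / (2 * s) * x)) / ((x * s) * (x * s))) (at x)"
    unfolding growth_weight_def [abs_def] s_def
    by (rule DERIV_divide) (use assms in simp)
  have "(exp (- (4 * G) / s) * ((0 * s - (- (4 * G)) * (1 / (2 * s))) / (s * s)) * (x * s)
        - exp (- (4 * G) / s) * (1 * s + 1 / (2 * s) * x)) / ((x * s) * (x * s))
      = growth_weight G x * (2 * G / (x * sqrt x) - 3 / (2 * x))"
    unfolding growth_weight_def s_def[symmetric] using s(1) unfolding s(2) by (simp add: field_simps)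
  with D show ?thesis by simp
qed

lemma growth_lower:
  assumes X: "0 < X" "X \<le> x"
    and d: "\<And>t. X \<le> t \<Longrightarrow> (F has_real_derivative F' t) (at t)"
    and le: "\<And>t. X \<le> t \<Longrightarrow> (3 / (2 * t) - 2 * G / (t * sqrt t)) * F t \<le> F' t"
  shows "F X * growth_weight G X \<le> F x * growth_weight G x"
proof (rule DERIV_nonneg_imp_nondecreasing[OF X(2)])
  fix t assume t: "X \<le> t" "t \<le> x"
  then have t0: "0 < t" using X by simp
  have D: "((\<lambda>t. F t * growth_weight G t) has_real_derivative
      F' t * growth_weight G t + growth_weight G t * (2 * G / (t * sqrt t) - 3 / (2 * t)) * F t) (at t)"
    by (rule DERIV_mult[OF d[OF t(1)] growth_weight_deriv[OF t0]])
  have "0 \<le> growth_weight G t * (F' t - (3 / (2 * t) - 2 * G / (t * sqrt t)) * F t)"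
    using le[OF t(1)] growth_weight_pos[OF t0, of G] by simp
  then have "0 \<le> F' t * growth_weight G t + growth_weight G t * (2 * G / (t * sqrt t) - 3 / (2 * t)) * F t"
    by (simp only: algebra_simps)
  with D show "\<exists>y. ((\<lambda>t. F t * growth_weight G t) has_real_derivative y) (at t) \<and> 0 \<le> y"
    by blast
qed

lemma growth_upper:
  assumes X: "0 < X" "X \<le> x"
    and d: "\<And>t. X \<le> t \<Longrightarrow> (F has_real_derivative F' t) (at t)"
    and le: "\<And>t. X \<le> t \<Longrightarrow> F' t \<le> (3 / (2 * t) + 2 * G / (t * sqrt t)) * F t"
  shows "F x * growth_weight (- G) x \<le> F X * growth_weight (- G) X"
  using growth_lower[OF X, of "\<lambda>t. - F t" "\<lambda>t. - F' t" "- G"] d le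
  by (simp add: DERIV_minus)

text \<open>Along the integers the values form a Cauchy sequence; passing to the limit in the
  hypothesis gives the rate, and the rate gives convergence along the reals. The explicit rate later
  permits the interchange of limits.\<close>

lemma inverse_sqrt_cauchy:
  fixes f :: "real \<Rightarrow> complex"
  assumes X: "0 < X" and c: "\<And>x x'. X \<le> x \<Longrightarrow> x \<le> x' \<Longrightarrow> norm (f x' - f x) \<le> c / sqrt x"
  obtains L where "(f \<longlongrightarrow> L) at_top" "\<And>x. X \<le> x \<Longrightarrow> norm (L - f x) \<le> c / sqrt x"
proof -
  have lim0: "((\<lambda>x. c / sqrt x) \<longlongrightarrow> 0) at_top"
    by (rule tendsto_divide_0[OF tendsto_const filterlim_at_top_imp_at_infinity[OF sqrt_at_top]])
  have "Cauchy (\<lambda>n. f (real n))"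
  proof (rule CauchyI)
    fix e :: real assume e: "0 < e"
    have "\<forall>\<^sub>F x in at_top. c / sqrt x < e / 2 \<and> X \<le> x"
      using order_tendstoD(2)[OF lim0, of "e / 2"] e eventually_ge_at_top[of X] by (auto intro: eventually_conj)
    then obtain M where M: "\<And>x. M \<le> x \<Longrightarrow> c / sqrt x < e / 2 \<and> X \<le> x"
      by (auto simp: eventually_at_top_linorder)
    obtain N :: nat where N: "M \<le> real N" using real_arch_simple by blast
    have b: "norm (f (real n) - f (real N)) < e / 2" if "N \<le> n" for n
      by (rule order.strict_trans1[OF c]) (use M[of "real N"] N that in auto)
    show "\<exists>M. \<forall>m\<ge>M. \<forall>n\<ge>M. norm (f (real m) - f (real n)) < e"
    proof (intro exI allI impI)
      fix m n assume "N \<le> m" "N \<le> n"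
      then show "norm (f (real m) - f (real n)) < e"
        using norm_triangle_ineq4[of "f (real m) - f (real N)" "f (real n) - f (real N)"] b[of m] b[of n]
        by simp
    qed
  qed
  then obtain L where L: "(\<lambda>n. f (real n)) \<longlonglongrightarrow> L"
    using Cauchy_convergent_iff convergent_def by blast
  have b: "norm (L - f x) \<le> c / sqrt x" if "X \<le> x" for x
  proof (rule tendsto_upperbound)
    show "((\<lambda>n. norm (f (real n) - f x)) \<longlongrightarrow> norm (L - f x)) sequentially"
      by (intro tendsto_intros L)
    obtain N :: nat where N: "x \<le> real N" using real_arch_simple by blast
    show "\<forall>\<^sub>F n in sequentially. norm (f (real n) - f x) \<le> c / sqrt x"
      using eventually_ge_at_top[of N] by eventually_elim (use c that N in force)
  qed simp
  have "((\<lambda>x. L - f x) \<longlongrightarrow> 0) at_top"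
    by (rule Lim_null_comparison[OF _ lim0]) (auto intro: eventually_mono[OF eventually_ge_at_top[of X]] b)
  then have "(f \<longlongrightarrow> L) at_top"
    using tendsto_diff[OF tendsto_const[of L]] by fastforce
  then show thesis using b by (rule that)
qed

definition growth_const :: "real \<Rightarrow> real" where
  "growth_const tau = defect_upper tau / ratio_lower tau"

context half_strip
begin

lemma constants_pos: "0 < ratio_lower tau" "0 < ratio_upper tau" "0 < defect_upper tau" "0 < growth_const tau"
proof -
  show 1: "0 < ratio_lower tau" using tau Einf_pos by (simp add: ratio_lower_def)
  show "0 < ratio_upper tau" using tau Einf_pos by (simp add: ratio_upper_def add_pos_nonneg)
  show 2: "0 < defect_upper tau" using tau Einf_pos Eaux_pos[of 1] by (simp add: defect_upper_def add_pos_pos)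
  show "0 < growth_const tau" using 1 2 by (simp add: growth_const_def)
qed

text \<open>The order x^(-3/2) is integrable at infinity, so the defect changes the growth of the
  denominator by a bounded factor only.\<close>

lemma defect_ratio_bound:
  assumes "1 \<le> x" "Einf / tau \<le> x"
  shows "norm (wkb_defect lam x) / - Im (wkb_ratio lam x) \<le> growth_const tau / (x * sqrt x)"
proof -
  have "norm (wkb_defect lam x) / - Im (wkb_ratio lam x) \<le> (defect_upper tau / x) / (ratio_lower tau * sqrt x)"
    using wkb_defect_bound[OF assms] wkb_ratio_bounds[OF assms] constants_pos assms(1)
    by (intro frac_le) auto
  then show ?thesis by (simp add: growth_const_def mult_ac)
qed

context
  fixes y z X
  assumes sol: "system_solution {0<..} lam y z"
    and X: "1 \<le> X" "Einf / tau \<le> X"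
    and nonneg: "\<And>x. X \<le> x \<Longrightarrow> 0 \<le> Im (y x * cnj (z x))"
begin

text \<open>Im ((y - r z) \<open>cnj z\<close>) is the sum of Im (y \<open>cnj z\<close>) and -Im r
  |z|^2, both nonnegative, and it is at most |y - r z| |z|.\<close>

lemma ratio_dominates:
  assumes "X \<le> x"
  shows "- Im (wkb_ratio lam x) * norm (z x) \<le> norm (y x - wkb_ratio lam x * z x)"
proof (cases "z x = 0")
  case False
  let ?r = "wkb_ratio lam x"
  have "Im ((y x - ?r * z x) * cnj (z x)) = Im (y x * cnj (z x)) - Im ?r * norm (z x) ^ 2"
    unfolding cmod_power2 by (simp add: algebra_simps power2_eq_square)
  then have "- Im ?r * norm (z x) ^ 2 \<le> Im ((y x - ?r * z x) * cnj (z x))"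
    using nonneg[OF assms] by linarith
  also have "\<dots> \<le> norm (y x - ?r * z x) * norm (z x)"
    using abs_Im_le_cmod[of "(y x - ?r * z x) * cnj (z x)"] by (simp add: norm_mult)
  finally have "(- Im ?r * norm (z x)) * norm (z x) \<le> norm (y x - ?r * z x) * norm (z x)"
    by (simp add: power2_eq_square mult_ac)
  then show ?thesis by (rule mult_right_le_imp_le) (use False in simp)
qed simp

text \<open>Domination replaces |z| by |y - r z| / (-Im r), which turns the equation for |y - r z|^2
  into a closed differential inequality.\<close>

lemma defect_term_bound:
  assumes "X \<le> x"
  shows "\<bar>Re (cnj (y x - wkb_ratio lam x * z x) * (wkb_defect lam x * z x))\<bar>
    \<le> growth_const tau / (x * sqrt x) * norm (y x - wkb_ratio lam x * z x) ^ 2"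
proof -
  let ?B = "norm (y x - wkb_ratio lam x * z x)" and ?i = "- Im (wkb_ratio lam x)"
  have x: "1 \<le> x" "Einf / tau \<le> x" using X assms by auto
  have "0 < ratio_lower tau * sqrt x" using constants_pos x by simp
  then have i: "0 < ?i" using wkb_ratio_bounds(1)[OF x] by linarith
  have "norm (z x) \<le> ?B / ?i"
    using ratio_dominates[OF assms] by (subst pos_le_divide_eq[OF i]) (simp only: mult.commute)
  then have "norm (wkb_defect lam x) * norm (z x) \<le> norm (wkb_defect lam x) * (?B / ?i)"
    by (intro mult_left_mono) auto
  also have "\<dots> = norm (wkb_defect lam x) / ?i * ?B" by simp
  also have "\<dots> \<le> growth_const tau / (x * sqrt x) * ?B"
    using defect_ratio_bound[OF x] by (intro mult_right_mono) auto
  finally have "?B * (norm (wkb_defect lam x) * norm (z x)) \<le> ?B * (growth_const tau / (x * sqrt x) * ?B)"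
    by (intro mult_left_mono) auto
  also have "?B * (norm (wkb_defect lam x) * norm (z x))
      = norm (cnj (y x - wkb_ratio lam x * z x) * (wkb_defect lam x * z x))"
    by (simp only: norm_mult complex_mod_cnj)
  also have "?B * (growth_const tau / (x * sqrt x) * ?B) = growth_const tau / (x * sqrt x) * ?B ^ 2"
    by (simp only: power2_eq_square mult_ac)
  finally have "norm (cnj (y x - wkb_ratio lam x * z x) * (wkb_defect lam x * z x))
      \<le> growth_const tau / (x * sqrt x) * ?B ^ 2" .
  then show ?thesis using abs_Re_le_cmod order_trans by blast
qed

lemma wkb_norm_square_deriv:
  assumes "X \<le> x"
  defines "B \<equiv> \<lambda>x. y x - wkb_ratio lam x * z x"
  shows "((\<lambda>x. norm (B x) ^ 2) has_real_derivative
      2 * ((3 / (4 * x) + x * Im (wkb_root lam x)) * norm (B x) ^ 2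
        + Re (cnj (B x) * (wkb_defect lam x * z x)))) (at x)"
proof -
  have x: "1 \<le> x" "Einf / tau \<le> x" using X assms by auto
  let ?K = "of_real (3 / (4 * x)) - \<i> * of_real x * wkb_root lam x"
  have eq: "Re (cnj b * (K * b + d)) = Re K * norm b ^ 2 + Re (cnj b * d)" for b K d :: complex
    unfolding cmod_power2 by (simp add: algebra_simps power2_eq_square)
  have K: "Re ?K = 3 / (4 * x) + x * Im (wkb_root lam x)" by simp
  show ?thesis
    unfolding B_def
    using has_real_derivative_norm_square[OF wkb_deriv[OF x sol]] unfolding eq K .
qed

text \<open>The contribution x Im S to the growth rate is nonnegative and is dropped;
  \<open>growth_lower\<close> then gives growth at least like x^(3/2).\<close>

lemma wkb_norm_lower:
  assumes "X \<le> x"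
  defines "B \<equiv> \<lambda>x. y x - wkb_ratio lam x * z x"
  shows "norm (B X) ^ 2 * growth_weight (growth_const tau) X * (x * sqrt x) \<le> norm (B x) ^ 2"
proof -
  let ?G = "growth_const tau"
  have x0: "0 < X" "0 < x" using X assms by auto
  have alg: "(3 / (2 * t) - 2 * g) * p \<le> 2 * ((3 / (4 * t) + i) * p + R)"
    if "0 \<le> i * p" "- (g * p) \<le> R" for t g p i R :: real
    using that by (simp add: algebra_simps)
  have "norm (B X) ^ 2 * growth_weight ?G X \<le> norm (B x) ^ 2 * growth_weight ?G x"
  proof (rule growth_lower[OF x0(1) assms(1)])
    fix t assume t: "X \<le> t"
    show "((\<lambda>x. norm (B x) ^ 2) has_real_derivative
      2 * ((3 / (4 * t) + t * Im (wkb_root lam t)) * norm (B t) ^ 2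
        + Re (cnj (B t) * (wkb_defect lam t * z t)))) (at t)"
      unfolding B_def by (rule wkb_norm_square_deriv[OF t])
    have tt: "1 \<le> t" "Einf / tau \<le> t" using X t by auto
    have "0 \<le> t * Im (wkb_root lam t) * norm (B t) ^ 2"
      using wkb_root_bounds(2)[OF tt] tt by simp
    moreover have "- (?G / (t * sqrt t) * norm (B t) ^ 2) \<le> Re (cnj (B t) * (wkb_defect lam t * z t))"
      using defect_term_bound[OF t] unfolding B_def by linarith
    note alg = alg[OF calculation this]
    show "(3 / (2 * t) - 2 * ?G / (t * sqrt t)) * norm (B t) ^ 2
      \<le> 2 * ((3 / (4 * t) + t * Im (wkb_root lam t)) * norm (B t) ^ 2
        + Re (cnj (B t) * (wkb_defect lam t * z t)))"
      using alg by simp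
  qed
  also have "\<dots> \<le> norm (B x) ^ 2 * (1 / (x * sqrt x))"
    using x0 constants_pos unfolding growth_weight_def
    by (intro mult_left_mono divide_right_mono) auto
  finally show ?thesis using x0 by (simp add: field_simps)
qed

text \<open>On the real axis S is real, so x Im S vanishes and the growth is also at most like
  x^(3/2).\<close>

lemma wkb_norm_upper:
  assumes "X \<le> x" "Im lam = 0"
  defines "B \<equiv> \<lambda>x. y x - wkb_ratio lam x * z x"
  shows "norm (B x) ^ 2 \<le> norm (B X) ^ 2 * growth_weight (- growth_const tau) X * (x * sqrt x)"
proof -
  let ?G = "growth_const tau"
  have x0: "0 < X" "0 < x" using X assms by auto
  have alg: "2 * ((3 / (4 * t) + t * i) * p + R) \<le> (3 / (2 * t) + 2 * g) * p"
    if "i = 0" "R \<le> g * p" for t g p i R :: real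
    using that by (simp add: algebra_simps)
  have "norm (B x) ^ 2 * (1 / (x * sqrt x)) \<le> norm (B x) ^ 2 * growth_weight (- ?G) x"
    using x0 constants_pos unfolding growth_weight_def
    by (intro mult_left_mono divide_right_mono) auto
  also have "\<dots> \<le> norm (B X) ^ 2 * growth_weight (- ?G) X"
  proof (rule growth_upper[OF x0(1) assms(1)])
    fix t assume t: "X \<le> t"
    show "((\<lambda>x. norm (B x) ^ 2) has_real_derivative
      2 * ((3 / (4 * t) + t * Im (wkb_root lam t)) * norm (B t) ^ 2
        + Re (cnj (B t) * (wkb_defect lam t * z t)))) (at t)"
      unfolding B_def by (rule wkb_norm_square_deriv[OF t])
    have tt: "1 \<le> t" "Einf / tau \<le> t" using X t by auto
    have "Im (wkb_root lam t) = 0"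
      using wkb_root_bounds(3)[OF tt] assms(2) by simp
    moreover have "Re (cnj (B t) * (wkb_defect lam t * z t)) \<le> ?G / (t * sqrt t) * norm (B t) ^ 2"
      using defect_term_bound[OF t] unfolding B_def by linarith
    note alg = alg[OF calculation this]
    show "2 * ((3 / (4 * t) + t * Im (wkb_root lam t)) * norm (B t) ^ 2
        + Re (cnj (B t) * (wkb_defect lam t * z t)))
      \<le> (3 / (2 * t) + 2 * ?G / (t * sqrt t)) * norm (B t) ^ 2"
      using alg by simp
  qed
  finally show ?thesis using x0 by (simp add: field_simps)
qed

end

end

section \<open>The flux and the convergence of the approximants\<close>

text \<open>The terms from the diagonal of the system cancel against the derivative of 1/x. The
  imaginary part of the result is Im lam |y|^2, so the imaginary part of the flux is monotone in the
  closed upper half-plane.\<close>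

lemma flux_deriv:
  assumes "system_solution {0<..} lam y z" "0 < x"
  shows "((\<lambda>x. y x * cnj (z x) / of_real x) has_vector_derivative
     of_real (pcoef x / x * norm (z x) ^ 2) - cnj lam * of_real (norm (y x) ^ 2)) (at x)"
proof -
  have x: "x \<in> {0<..}" "x \<noteq> 0" using assms(2) by auto
  note d = system_solution_iff[OF assms(1) x(1) assms(2)]
  have "((\<lambda>x. y x * cnj (z x) / of_real x) has_vector_derivative
      (y x * cnj (of_real x * z x - lam * of_real x * y x)
        + (of_real (1 / x - x) * y x + of_real (pcoef x) * z x) * cnj (z x)) / of_real x
      - (y x * cnj (z x)) / of_real x ^ 2) (at x)"
    by (intro has_vector_derivative_divide_real has_vector_derivative_mult
        has_vector_derivative_cnj d x)
  moreover have "(y x * cnj (of_real x * z x - lam * of_real x * y x)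
        + (of_real (1 / x - x) * y x + of_real (pcoef x) * z x) * cnj (z x)) / of_real x
      - (y x * cnj (z x)) / of_real x ^ 2
      = of_real (pcoef x / x) * (z x * cnj (z x)) - cnj lam * (y x * cnj (y x))"
    using x by (simp add: field_simps power2_eq_square)
  ultimately show ?thesis unfolding complex_norm_square of_real_mult by simp
qed

text \<open>Comparison with the antiderivative \<open>- (2 * D) / sqrt t\<close> of the
  bound.\<close>

lemma bounded_by_inverse_sqrt:
  fixes q q' :: "real \<Rightarrow> complex"
  assumes X: "0 < X"
    and d: "\<And>x. X \<le> x \<Longrightarrow> (q has_vector_derivative q' x) (at x)"
    and b: "\<And>x. X \<le> x \<Longrightarrow> norm (q' x) \<le> D / (x * sqrt x)"
    and x: "X \<le> x" "x \<le> x'"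
  shows "norm (q x' - q x) \<le> 2 * D / sqrt x"
proof -
  have x0: "0 < x" "0 < x * sqrt x" using X x by auto
  have "0 \<le> D / (x * sqrt x)" using b[OF x(1)] norm_ge_zero order_trans by blast
  then have 0: "0 \<le> D" using x0 by (simp only: zero_le_divide_iff) auto
  have ds: "((\<lambda>t. - (2 * D) / sqrt t) has_vector_derivative D / (t * sqrt t)) (at t)" if "0 < t" for t
  proof -
    note dd = DERIV_divide[OF DERIV_const[of "- (2 * D)"] DERIV_real_sqrt[OF that]]
    have "(0 * sqrt t - - (2 * D) * (inverse (sqrt t) / 2)) / (sqrt t * sqrt t) = D / (t * sqrt t)"
      using that by (simp add: field_simps)
    then show ?thesis
      using dd that by (simp add: has_real_derivative_iff_has_vector_derivative)
  qed
  have "norm (q x' - q x) \<le> - (2 * D) / sqrt x' - - (2 * D) / sqrt x" if xx: "x < x'"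
  proof (rule differentiable_bound_general[OF xx])
    show "continuous_on {x..x'} q"
      using x by (intro continuous_at_imp_continuous_on ballI)
        (auto intro!: has_vector_derivative_continuous[OF d])
    show "continuous_on {x..x'} (\<lambda>t. - (2 * D) / sqrt t)"
      using x0 by (intro continuous_intros) auto
    fix t assume t: "x < t" "t < x'"
    show "(q has_vector_derivative q' t) (at t)" by (rule d) (use t x in simp)
    show "((\<lambda>t. - (2 * D) / sqrt t) has_vector_derivative D / (t * sqrt t)) (at t)"
      by (rule ds) (use t x0 in simp)
    show "norm (q' t) \<le> D / (t * sqrt t)" by (rule b) (use t x in simp)
  qed
  moreover have "- (2 * D) / sqrt x' - - (2 * D) / sqrt x \<le> 2 * D / sqrt x" "0 \<le> 2 * D / sqrt x"
    using 0 x0 x by auto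
  ultimately show ?thesis using x(2) by (cases "x = x'") auto
qed

definition weyl_approx ::
    "complex \<Rightarrow> (real \<Rightarrow> complex) \<Rightarrow> (real \<Rightarrow> complex) \<Rightarrow> (real \<Rightarrow> complex) \<Rightarrow> (real \<Rightarrow> complex) \<Rightarrow> real \<Rightarrow> complex" where
  "weyl_approx lam y0 z0 y1 z1 x =
     - ((y0 x - wkb_ratio lam x * z0 x) / (y1 x - wkb_ratio lam x * z1 x))"

text \<open>The constant in the rate of convergence of \<open>weyl_approx\<close>. The solution and
  the WKB ratio enter only through the denominator at the single point \<open>X\<close>, so
  continuity in the parameter can be checked there.\<close>

definition weyl_error ::
    "real \<Rightarrow> complex \<Rightarrow> complex \<Rightarrow> (real \<Rightarrow> complex) \<Rightarrow> (real \<Rightarrow> complex) \<Rightarrow> real \<Rightarrow> real" where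
  "weyl_error tau lam w y1 z1 X = 2 * (defect_upper tau * norm w /
     (norm (y1 X - wkb_ratio lam X * z1 X) ^ 2 * growth_weight (growth_const tau) X))"

context half_strip
begin

context
  fixes y0 z0 y1 z1 :: "real \<Rightarrow> complex" and w :: complex and xs X :: real
  assumes sol0: "system_solution {0<..} lam y0 z0"
    and sol1: "system_solution {0<..} lam y1 z1"
    and det: "\<And>x. 0 < x \<Longrightarrow> y0 x * z1 x - z0 x * y1 x = w * of_real x"
    and w: "w \<noteq> 0"
    and xs: "0 < xs" "y1 xs = 0"
    and X: "xs \<le> X" "1 \<le> X" "Einf / tau \<le> X"
begin

text \<open>The flux vanishes at \<open>xs\<close> because \<open>y1 xs = 0\<close>, and its
  imaginary part has derivative Im lam |y1|^2 \<ge> 0.\<close>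

lemma flux_nonneg:
  assumes "xs \<le> x"
  shows "0 \<le> Im (y1 x * cnj (z1 x))"
proof -
  let ?F = "\<lambda>x. Im (y1 x * cnj (z1 x) / of_real x)"
  have "?F xs \<le> ?F x"
  proof (rule DERIV_nonneg_imp_nondecreasing[OF assms])
    fix t assume "xs \<le> t"
    then have t: "0 < t" using xs by simp
    show "\<exists>d. (?F has_real_derivative d) (at t) \<and> 0 \<le> d"
      using has_field_derivative_Im[OF flux_deriv[OF sol1 t]] Im_lam(1) by fastforce
  qed
  then have "0 \<le> ?F x" using xs by simp
  moreover have "?F x = Im (y1 x * cnj (z1 x)) / x" by (rule Im_divide_of_real)
  ultimately show ?thesis using assms xs by (simp only: zero_le_divide_iff) auto
qed

text \<open>A zero would force \<open>z1 x = 0\<close> by domination, then \<open>y1 x = 0\<close>,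
  contradicting the determinant.\<close>

lemma weyl_denominator_nonzero:
  assumes "X \<le> x" shows "y1 x - wkb_ratio lam x * z1 x \<noteq> 0"
proof
  assume 0: "y1 x - wkb_ratio lam x * z1 x = 0"
  have x: "1 \<le> x" "Einf / tau \<le> x" "0 < x" using X assms by auto
  have "- Im (wkb_ratio lam x) * norm (z1 x) \<le> 0"
    using ratio_dominates[OF sol1 X(2,3) flux_nonneg assms] X 0 by simp
  moreover have "0 < - Im (wkb_ratio lam x)"
    using wkb_ratio_bounds(1)[OF x(1,2)] constants_pos(1) x
    by (smt (verit) mult_pos_pos real_sqrt_gt_zero)
  ultimately have "z1 x = 0"
    by (smt (verit) mult_pos_pos zero_less_norm_iff)
  with 0 have "y1 x = 0" by simp
  with \<open>z1 x = 0\<close> det[OF x(3)] w x show False by simp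
qed

text \<open>Numerator A and denominator B satisfy the same scalar equation up to the defect, so its
  coefficient cancels in (A / B)'. What remains is the defect times A z1 - z0 B, where the terms
  with r cancel and the determinant is left.\<close>

lemma weyl_approx_deriv:
  assumes "X \<le> x"
  shows "(weyl_approx lam y0 z0 y1 z1 has_vector_derivative
    wkb_defect lam x * (w * of_real x) / (y1 x - wkb_ratio lam x * z1 x) ^ 2) (at x)"
proof -
  define A where "A x = y0 x - wkb_ratio lam x * z0 x" for x
  define B where "B x = y1 x - wkb_ratio lam x * z1 x" for x
  define K where "K = of_real (3 / (4 * x)) - \<i> * of_real x * wkb_root lam x"
  have x: "1 \<le> x" "Einf / tau \<le> x" "0 < x" using X assms by auto
  have dA: "(A has_vector_derivative K * A x + wkb_defect lam x * z0 x) (at x)"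
    using wkb_deriv[OF x(1,2) sol0] unfolding A_def [abs_def] K_def .
  have dB: "(B has_vector_derivative K * B x + wkb_defect lam x * z1 x) (at x)"
    using wkb_deriv[OF x(1,2) sol1] unfolding B_def [abs_def] K_def .
  have B0: "B x \<noteq> 0" using weyl_denominator_nonzero[OF assms] by (simp add: B_def)
  have "(inverse has_field_derivative - (1 / B x ^ 2)) (at (B x))"
    using DERIV_inverse[OF B0] by (simp add: power2_eq_square divide_inverse)
  from field_vector_diff_chain_at[OF dB this]
  have di: "((\<lambda>x. inverse (B x)) has_vector_derivative
      (K * B x + wkb_defect lam x * z1 x) * - (1 / B x ^ 2)) (at x)"
    by (simp add: o_def)
  have "((\<lambda>x. - (A x * inverse (B x))) has_vector_derivative
      - (A x * ((K * B x + wkb_defect lam x * z1 x) * - (1 / B x ^ 2))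
         + (K * A x + wkb_defect lam x * z0 x) * inverse (B x))) (at x)"
    by (intro has_vector_derivative_minus has_vector_derivative_mult dA di)
  moreover have "- (A x * ((K * B x + wkb_defect lam x * z1 x) * - (1 / B x ^ 2))
         + (K * A x + wkb_defect lam x * z0 x) * inverse (B x))
      = wkb_defect lam x * (A x * z1 x - z0 x * B x) / B x ^ 2"
    using B0 by (simp add: field_simps power2_eq_square)
  moreover have "A x * z1 x - z0 x * B x = w * of_real x"
    using det[OF x(3)] by (simp add: A_def B_def algebra_simps)
  moreover have "weyl_approx lam y0 z0 y1 z1 = (\<lambda>x. - (A x * inverse (B x)))"
    by (auto simp: weyl_approx_def A_def B_def divide_inverse)
  ultimately show ?thesis by (simp add: B_def)
qed

text \<open>Defect times determinant is bounded, and the squared denominator is at least a multiple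
  of x^(3/2).\<close>

lemma weyl_approx_cauchy:
  assumes "X \<le> x" "x \<le> x'"
  shows "norm (weyl_approx lam y0 z0 y1 z1 x' - weyl_approx lam y0 z0 y1 z1 x)
    \<le> weyl_error tau lam w y1 z1 X / sqrt x"
proof -
  let ?n = "norm (y1 X - wkb_ratio lam X * z1 X) ^ 2 * growth_weight (growth_const tau) X"
  have n: "0 < ?n"
    using weyl_denominator_nonzero[of X] growth_weight_pos X by simp
  have "norm (weyl_approx lam y0 z0 y1 z1 x' - weyl_approx lam y0 z0 y1 z1 x)
    \<le> 2 * (defect_upper tau * norm w / ?n) / sqrt x"
  proof (rule bounded_by_inverse_sqrt[OF _ weyl_approx_deriv _ assms])
    fix t assume t: "X \<le> t"
    have tt: "1 \<le> t" "Einf / tau \<le> t" "0 < t" using X t by auto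
    have "norm (wkb_defect lam t * (w * of_real t)) \<le> defect_upper tau / t * (norm w * t)"
      unfolding norm_mult norm_of_real using wkb_defect_bound[OF tt(1,2)] tt constants_pos(3)
      by (intro mult_mono) auto
    also have "\<dots> = defect_upper tau * norm w" using tt by simp
    finally have 1: "norm (wkb_defect lam t * (w * of_real t)) \<le> defect_upper tau * norm w" .
    have 2: "?n * (t * sqrt t) \<le> norm (y1 t - wkb_ratio lam t * z1 t) ^ 2"
      using wkb_norm_lower[OF sol1 X(2,3) flux_nonneg t] X by simp
    have "norm (wkb_defect lam t * (w * of_real t)) / norm (y1 t - wkb_ratio lam t * z1 t) ^ 2
        \<le> defect_upper tau * norm w / (?n * (t * sqrt t))"
      using 1 2 mult_pos_pos[OF n, of "t * sqrt t"] tt constants_pos by (intro frac_le) auto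
    then show "norm (wkb_defect lam t * (w * of_real t) / (y1 t - wkb_ratio lam t * z1 t) ^ 2)
        \<le> defect_upper tau * norm w / ?n / (t * sqrt t)"
      by (simp add: norm_divide norm_power)
  qed (use X in auto)
  then show ?thesis by (simp add: weyl_error_def)
qed

lemma weyl_approx_limit:
  obtains Q where "(weyl_approx lam y0 z0 y1 z1 \<longlongrightarrow> Q) at_top"
    "\<And>x. X \<le> x \<Longrightarrow> norm (Q - weyl_approx lam y0 z0 y1 z1 x) \<le> weyl_error tau lam w y1 z1 X / sqrt x"
proof -
  have "0 < X" using X by simp
  from inverse_sqrt_cauchy[OF this weyl_approx_cauchy] show thesis using that by blast
qed

text \<open>For real spectral parameter and real initial data the approximants stay away from the real
  axis, because the squared denominator grows exactly like \<open>x\<^bsup>3/2\<^esup>\<close>.\<close>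

lemma weyl_limit_Im_pos:
  assumes Q: "(weyl_approx lam y0 z0 y1 z1 \<longlongrightarrow> Q) at_top"
    and real: "Im lam = 0" "\<And>x. 0 < x \<Longrightarrow> y0 x \<in> \<real> \<and> z0 x \<in> \<real> \<and> y1 x \<in> \<real> \<and> z1 x \<in> \<real>"
    and w': "w = of_real v" "0 < v"
  shows "0 < Im Q"
proof -
  let ?n = "norm (y1 X - wkb_ratio lam X * z1 X) ^ 2 * growth_weight (- growth_const tau) X"
  have n: "0 < ?n"
    using weyl_denominator_nonzero[of X] growth_weight_pos X by simp
  have "ratio_lower tau * v / ?n \<le> Im (weyl_approx lam y0 z0 y1 z1 x)" if t: "X \<le> x" for x
  proof -
    let ?r = "wkb_ratio lam x"
    define A where "A = y0 x - ?r * z0 x"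
    define B where "B = y1 x - ?r * z1 x"
    have x: "1 \<le> x" "Einf / tau \<le> x" "0 < x" using X t by auto
    have B0: "0 < norm B ^ 2" using weyl_denominator_nonzero[OF t] by (simp add: B_def)
    have up: "norm B ^ 2 \<le> ?n * (x * sqrt x)"
      using wkb_norm_upper[OF sol1 X(2,3) flux_nonneg t real(1)] X by (simp add: B_def)
    have reals: "Im (y0 x) = 0" "Im (z0 x) = 0" "Im (y1 x) = 0" "Im (z1 x) = 0"
      using real(2)[OF x(3)] by (auto simp: complex_is_Real_iff)
    have "Re (y0 x) * Re (z1 x) - Re (z0 x) * Re (y1 x) = v * x"
      using arg_cong[OF det[OF x(3)], of Re] reals w' by simp
    \<comment> \<open>For real entries the terms with |r|^2 and Re r are real, so only Im r times
      the determinant survives.\<close>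
    moreover have "Im (A * cnj B) = Im ?r * (Re (y0 x) * Re (z1 x) - Re (z0 x) * Re (y1 x))"
      by (simp add: A_def B_def reals algebra_simps)
    ultimately have AB: "- Im (A * cnj B) = - Im ?r * (v * x)" by simp
    have "weyl_approx lam y0 z0 y1 z1 x = - (A / B)"
      by (simp add: weyl_approx_def A_def B_def)
    also have "\<dots> = - (A * cnj B) / of_real (norm B ^ 2)"
      by (simp add: complex_div_cnj[of A B])
    finally have "Im (weyl_approx lam y0 z0 y1 z1 x) = - Im (A * cnj B) / norm B ^ 2"
      by (simp only: Im_divide_of_real uminus_complex.simps)
    also have "\<dots> = - Im ?r * (v * x) / norm B ^ 2" unfolding AB ..
    also have "\<dots> \<ge> (ratio_lower tau * sqrt x) * (v * x) / (?n * (x * sqrt x))"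
      using wkb_ratio_bounds(1)[OF x(1,2)] constants_pos(1) x w' up B0
      by (intro frac_le mult_right_mono mult_nonneg_nonneg order_trans[of 0 "ratio_lower tau * sqrt x" "- Im ?r"]) auto
    also have "(ratio_lower tau * sqrt x) * (v * x) / (?n * (x * sqrt x)) = ratio_lower tau * v / ?n"
      using x n by (simp add: field_simps)
    finally show ?thesis .
  qed
  then have "\<forall>\<^sub>F x in at_top. ratio_lower tau * v / ?n \<le> Im (weyl_approx lam y0 z0 y1 z1 x)"
    by (rule eventually_mono[OF eventually_ge_at_top[of X]])
  then have "ratio_lower tau * v / ?n \<le> Im Q"
    by (intro tendsto_lowerbound[OF tendsto_Im[OF Q]]) auto
  moreover have "0 < ratio_lower tau * v / ?n"
    by (rule divide_pos_pos[OF mult_pos_pos[OF constants_pos(1) w'(2)] n])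
  ultimately show ?thesis by linarith
qed

text \<open>For nonreal spectral parameter the limit point property holds in the quantitative form that
  \<open>Im (y z\<^sup>* / x) + Im (\<lambda> y z\<^sup>* / x)\<close> has derivative \<open>Im \<lambda> (\<bar>y\<bar>\<^sup>2 + p \<bar>z\<bar>\<^sup>2 / x)\<close>, which is bounded
  below by a multiple of the squared denominator.\<close>

lemma flux_unbounded:
  assumes lam: "0 < Im lam"
  shows "filterlim (\<lambda>x. (1 + norm lam) * (norm (y1 x) * norm (z1 x) / x)) at_top at_top"
proof -
  define F where "F x = y1 x * cnj (z1 x) / of_real x" for x
  define U where "U x = Im (F x) + Im (lam * F x)" for x
  define n where "n = norm (y1 X - wkb_ratio lam X * z1 X) ^ 2 * growth_weight (growth_const tau) X"
  \<comment> \<open>The squared denominator is at most 2 |y1|^2 + 2 |r|^2 |z1|^2, and |r|^2 is at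
    most \<open>ratio_upper tau ^ 2 * Einf / 2\<close> times p/x. So \<open>C\<close> dominates both
    coefficients, and \<open>e\<close> bounds the derivative of \<open>U\<close> from below.\<close>
  define C where "C = 2 + ratio_upper tau ^ 2 * Einf"
  define e where "e = Im lam * n / C"
  have n: "0 < n" using weyl_denominator_nonzero[of X] growth_weight_pos X by (simp add: n_def)
  have C: "0 < C" "2 \<le> C" using constants_pos Einf_pos by (auto simp: C_def intro!: add_pos_nonneg)
  have e: "0 < e" using n C lam by (simp add: e_def)
  have dU: "(U has_real_derivative Im lam * (norm (y1 x) ^ 2 + pcoef x / x * norm (z1 x) ^ 2)) (at x)"
    if "0 < x" for x
  proof -
    note dF = flux_deriv[OF sol1 that]
    have "(U has_real_derivative
        Im (of_real (pcoef x / x * norm (z1 x) ^ 2) - cnj lam * of_real (norm (y1 x) ^ 2))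
        + Im (lam * (of_real (pcoef x / x * norm (z1 x) ^ 2) - cnj lam * of_real (norm (y1 x) ^ 2)))) (at x)"
      unfolding U_def [abs_def] F_def
      by (intro DERIV_add has_field_derivative_Im has_vector_derivative_mult_right dF)
    then show ?thesis by (simp add: algebra_simps)
  qed
  have growth: "e \<le> Im lam * (norm (y1 x) ^ 2 + pcoef x / x * norm (z1 x) ^ 2)" if t: "X \<le> x" for x
  proof -
    let ?r = "wkb_ratio lam x"
    have x: "1 \<le> x" "Einf / tau \<le> x" "0 < x" "1 \<le> sqrt x" using X t by auto
    have "1 \<le> x * sqrt x" using mult_mono[of 1 x 1 "sqrt x"] x by simp
    then have "n * 1 \<le> n * (x * sqrt x)" using n by (intro mult_left_mono) auto
    also have "\<dots> \<le> norm (y1 x - ?r * z1 x) ^ 2"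
      using wkb_norm_lower[OF sol1 X(2,3) flux_nonneg t] X by (simp add: n_def)
    also have "\<dots> \<le> (norm (y1 x) + norm ?r * norm (z1 x)) ^ 2"
      using norm_triangle_ineq4[of "y1 x" "?r * z1 x"] by (intro power_mono) (auto simp: norm_mult)
    also have "\<dots> \<le> 2 * norm (y1 x) ^ 2 + 2 * norm ?r ^ 2 * norm (z1 x) ^ 2"
      using zero_le_power2[of "norm (y1 x) - norm ?r * norm (z1 x)"]
      by (simp add: power2_eq_square algebra_simps)
    also have "norm ?r ^ 2 \<le> ratio_upper tau ^ 2 * x"
      using power_mono[OF wkb_ratio_bounds(2)[OF x(1,2)], of 2] x by (simp add: power_mult_distrib)
    also have "ratio_upper tau ^ 2 * x \<le> ratio_upper tau ^ 2 * (Einf / 2 * (pcoef x / x))"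
      using pcoef_lower[OF x(3)] x Einf_pos
      by (intro mult_left_mono) (auto simp: field_simps power2_eq_square)
    finally have "n \<le> 2 * norm (y1 x) ^ 2
        + 2 * (ratio_upper tau ^ 2 * (Einf / 2 * (pcoef x / x))) * norm (z1 x) ^ 2"
      by (simp add: mult_right_mono)
    also have "\<dots> = 2 * norm (y1 x) ^ 2 + ratio_upper tau ^ 2 * Einf * (pcoef x / x * norm (z1 x) ^ 2)"
      by simp
    also have "\<dots> \<le> C * norm (y1 x) ^ 2 + C * (pcoef x / x * norm (z1 x) ^ 2)"
    proof (intro add_mono mult_right_mono C)
      have "0 \<le> pcoef x" using pcoef_eq[OF x(3)] Eaux_pos[OF x(3)] by simp
      then show "0 \<le> pcoef x / x * norm (z1 x) ^ 2" using x by simp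
    qed (auto simp: C_def)
    finally have "n / C \<le> norm (y1 x) ^ 2 + pcoef x / x * norm (z1 x) ^ 2"
      using C by (simp add: pos_divide_le_eq algebra_simps)
    then show ?thesis using lam unfolding e_def by (simp only: times_divide_eq_right[symmetric] mult_left_mono)
  qed
  have lower: "U X + e * (x - X) \<le> (1 + norm lam) * (norm (y1 x) * norm (z1 x) / x)" if t: "X \<le> x" for x
  proof -
    have x: "0 < x" using X t by simp
    have "U X - e * X \<le> U x - e * x"
    proof (rule DERIV_nonneg_imp_nondecreasing[OF t])
      fix s assume s: "X \<le> s"
      then have "0 < s" using X by simp
      then have "((\<lambda>s. U s - e * s) has_real_derivative
          Im lam * (norm (y1 s) ^ 2 + pcoef s / s * norm (z1 s) ^ 2) - e * 1) (at s)"
        by (intro DERIV_diff dU DERIV_cmult DERIV_ident)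
      with growth[OF s] show "\<exists>d. ((\<lambda>s. U s - e * s) has_real_derivative d) (at s) \<and> 0 \<le> d"
        by (intro exI conjI) auto
    qed
    moreover have "U x \<le> norm (F x) + norm lam * norm (F x)"
      unfolding U_def using abs_Im_le_cmod[of "F x"] abs_Im_le_cmod[of "lam * F x"]
      by (simp add: norm_mult)
    moreover have nF: "norm (F x) = norm (y1 x) * norm (z1 x) / x"
      using x by (simp add: F_def norm_divide norm_mult)
    moreover have "(1 + norm lam) * norm (F x) = norm (F x) + norm lam * norm (F x)"
      by (simp add: distrib_right)
    ultimately have "U X - e * X + e * x \<le> (1 + norm lam) * norm (F x)"
      by linarith
    then show ?thesis unfolding nF by (simp add: right_diff_distrib)
  qed
  have "filterlim (\<lambda>x. U X + e * (x - X)) at_top at_top"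
    by (rule filterlim_tendsto_add_at_top[OF tendsto_const])
      (rule filterlim_tendsto_pos_mult_at_top[OF tendsto_const e],
       use filterlim_tendsto_add_at_top[OF tendsto_const[of "- X"] filterlim_ident] in simp)
  then show ?thesis
    by (rule filterlim_at_top_mono) (rule eventually_mono[OF eventually_ge_at_top[of X] lower])
qed

text \<open>The approximant differs from - y0 / y1 by r det / (y1 B) in modulus, B being the
  denominator. Since |r| / |B| is at most a constant over |z1|, this is O(x / (|y1| |z1|)), which
  tends to 0 by \<open>flux_unbounded\<close>.\<close>

lemma weyl_ratio_limit:
  assumes Q: "(weyl_approx lam y0 z0 y1 z1 \<longlongrightarrow> Q) at_top" and lam: "0 < Im lam"
  shows "((\<lambda>x. y0 x / y1 x) \<longlongrightarrow> - Q) at_top"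
proof -
  define T where "T x = (1 + norm lam) * (norm (y1 x) * norm (z1 x) / x)" for x
  define C where "C = ratio_upper tau / ratio_lower tau * norm w * (1 + norm lam)"
  have T: "filterlim T at_top at_top"
    using flux_unbounded[OF lam] unfolding T_def [abs_def] .
  have bound: "norm (weyl_approx lam y0 z0 y1 z1 x + y0 x / y1 x) \<le> C / T x" if t: "X \<le> x" "0 < T x" for x
  proof -
    let ?r = "wkb_ratio lam x"
    define B where "B = y1 x - ?r * z1 x"
    have x: "1 \<le> x" "Einf / tau \<le> x" "0 < x" using X t by auto
    have B0: "B \<noteq> 0" using weyl_denominator_nonzero[OF t(1)] by (simp add: B_def)
    have y0: "y1 x \<noteq> 0" "z1 x \<noteq> 0" using t(2) by (auto simp: T_def)
    have ri: "0 < ratio_lower tau * sqrt x" using constants_pos x by simp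
    then have i: "0 < - Im ?r" using wkb_ratio_bounds(1)[OF x(1,2)] by linarith
    have "weyl_approx lam y0 z0 y1 z1 x + y0 x / y1 x
        = (y0 x * B - (y0 x - ?r * z0 x) * y1 x) / (y1 x * B)"
      using y0 B0 unfolding weyl_approx_def B_def[symmetric] by (simp add: field_simps)
    also have "y0 x * B - (y0 x - ?r * z0 x) * y1 x = - (?r * (y0 x * z1 x - z0 x * y1 x))"
      by (simp add: B_def algebra_simps)
    finally have "norm (weyl_approx lam y0 z0 y1 z1 x + y0 x / y1 x)
        = norm ?r * (norm w * x) / (norm (y1 x) * norm B)"
      unfolding det[OF x(3)] using x by (simp add: norm_divide norm_mult)
    also have "\<dots> \<le> ratio_upper tau * sqrt x * (norm w * x)
        / (norm (y1 x) * (ratio_lower tau * sqrt x * norm (z1 x)))"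
    proof (intro frac_le mult_mono mult_pos_pos ri)
      show "ratio_lower tau * sqrt x * norm (z1 x) \<le> norm B"
        using ratio_dominates[OF sol1 X(2,3) flux_nonneg t(1)] X
          mult_right_mono[OF wkb_ratio_bounds(1)[OF x(1,2)], of "norm (z1 x)"] by (simp add: B_def)
    qed (use wkb_ratio_bounds(2)[OF x(1,2)] constants_pos x y0 ri in auto)
    also have "\<dots> = C / T x"
    proof -
      have "1 + norm lam \<noteq> 0" using norm_ge_zero[of lam] by linarith
      then show ?thesis using x constants_pos y0 by (simp add: C_def T_def divide_simps)
    qed
    finally show ?thesis .
  qed
  have "\<forall>\<^sub>F x in at_top. X \<le> x \<and> 0 < T x"
    using eventually_ge_at_top[of X] filterlim_at_top_dense[THEN iffD1, OF T, rule_format, of 0]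
    by eventually_elim simp
  then have "\<forall>\<^sub>F x in at_top. norm (weyl_approx lam y0 z0 y1 z1 x + y0 x / y1 x) \<le> C / T x"
    by eventually_elim (use bound in blast)
  moreover have "((\<lambda>x. C / T x) \<longlongrightarrow> 0) at_top"
    by (rule tendsto_divide_0[OF tendsto_const filterlim_at_top_imp_at_infinity[OF T]])
  ultimately have "((\<lambda>x. weyl_approx lam y0 z0 y1 z1 x + y0 x / y1 x) \<longlongrightarrow> 0) at_top"
    by (rule Lim_null_comparison)
  from tendsto_diff[OF this Q] show ?thesis by simp
qed

end

end

section \<open>Boundary values of the Weyl function\<close>

locale normalized_system =
  fixes xs :: real and y0 z0 y1 z1 :: "complex \<Rightarrow> real \<Rightarrow> complex"
  assumes xs_pos: "0 < xs"
    and sol0: "\<And>lam. system_solution {0<..} lam (y0 lam) (z0 lam)"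
    and sol1: "\<And>lam. system_solution {0<..} lam (y1 lam) (z1 lam)"
    and initial: "\<And>lam. y0 lam xs = 1" "\<And>lam. z0 lam xs = 0"
      "\<And>lam. y1 lam xs = 0" "\<And>lam. z1 lam xs = 1"
begin

lemma det:
  assumes "0 < x"
  shows "y0 lam x * z1 lam x - z0 lam x * y1 lam x = of_real (1 / xs) * of_real x"
  using wronskian_const[OF sol0 sol1 assms xs_pos, of lam] assms by (simp add: initial field_simps)

text \<open>Cramer's rule with constant Wronskians; this takes the place of a uniqueness theorem for
  the system.\<close>

lemma solution_expansion:
  assumes sol: "system_solution {0<..} lam y z" and x: "0 < x"
  shows "y x = y0 lam x * y xs + y1 lam x * z xs" "z x = z0 lam x * y xs + z1 lam x * z xs"
proof -
  have u: "y x * z1 lam x - z x * y1 lam x = of_real x * (y xs / of_real xs)"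
    using wronskian_const[OF sol sol1 x xs_pos] x by (simp add: initial field_simps)
  have v: "y0 lam x * z x - z0 lam x * y x = of_real x * (z xs / of_real xs)"
    using wronskian_const[OF sol0 sol x xs_pos] x by (simp add: initial field_simps)
  have "of_real (1 / xs) * of_real x * y x
      = y0 lam x * (y x * z1 lam x - z x * y1 lam x) + y1 lam x * (y0 lam x * z x - z0 lam x * y x)"
    "of_real (1 / xs) * of_real x * z x
      = z0 lam x * (y x * z1 lam x - z x * y1 lam x) + z1 lam x * (y0 lam x * z x - z0 lam x * y x)"
    unfolding det[OF x, symmetric, of lam] by (simp_all add: algebra_simps)
  then have "of_real (x / xs) * y x = of_real (x / xs) * (y0 lam x * y xs + y1 lam x * z xs)"
    "of_real (x / xs) * z x = of_real (x / xs) * (z0 lam x * y xs + z1 lam x * z xs)"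
    unfolding u v by (simp_all add: distrib_left mult_ac)
  moreover have "complex_of_real (x / xs) \<noteq> 0" using x xs_pos by simp
  ultimately show "y x = y0 lam x * y xs + y1 lam x * z xs" "z x = z0 lam x * y xs + z1 lam x * z xs"
    using mult_left_cancel by blast+
qed

text \<open>The conjugate solutions have the same data at \<open>xs\<close>, so by the expansion
  they agree with the solutions themselves.\<close>

lemma real_parameter:
  assumes x: "0 < x"
  shows "y0 (of_real t) x \<in> \<real> \<and> z0 (of_real t) x \<in> \<real> \<and> y1 (of_real t) x \<in> \<real> \<and> z1 (of_real t) x \<in> \<real>"
proof -
  have s: "system_solution {0<..} (of_real t) (\<lambda>x. cnj (y0 (of_real t) x)) (\<lambda>x. cnj (z0 (of_real t) x))"
      "system_solution {0<..} (of_real t) (\<lambda>x. cnj (y1 (of_real t) x)) (\<lambda>x. cnj (z1 (of_real t) x))"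
    using system_solution_cnj[OF sol0, of "of_real t"] system_solution_cnj[OF sol1, of "of_real t"] by simp_all
  show ?thesis
    using solution_expansion[OF s(1) x] solution_expansion[OF s(2) x]
    by (simp add: initial Reals_cnj_iff)
qed

lemma continuous_in_parameter:
  assumes b: "xs < b"
  shows "((\<lambda>lam. y0 lam b) \<longlongrightarrow> y0 tau b) (at tau)" "((\<lambda>lam. z0 lam b) \<longlongrightarrow> z0 tau b) (at tau)"
    "((\<lambda>lam. y1 lam b) \<longlongrightarrow> y1 tau b) (at tau)" "((\<lambda>lam. z1 lam b) \<longlongrightarrow> z1 tau b) (at tau)"
proof -
  have cont: "isCont (y0 lam) x" "isCont (z0 lam) x" "isCont (y1 lam) x" "isCont (z1 lam) x"
    if "0 < x" for lam x
    using system_solution_isCont[OF sol0, of x lam] system_solution_isCont[OF sol1, of x lam] that by simp_all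
  have "continuous_on {xs..b} (y0 tau)" "continuous_on {xs..b} (y1 tau)"
    using cont xs_pos by (auto intro!: continuous_at_imp_continuous_on)
  note c = this
  obtain M0 where M0: "\<And>x. x \<in> {xs..b} \<Longrightarrow> norm (y0 tau x) \<le> M0"
    using continuous_on_Icc_norm_bound[OF c(1)] by blast
  obtain M1 where M1: "\<And>x. x \<in> {xs..b} \<Longrightarrow> norm (y1 tau x) \<le> M1"
    using continuous_on_Icc_norm_bound[OF c(2)] by blast
  have M: "norm (y0 tau x) \<le> max M0 M1" "norm (y1 tau x) \<le> max M0 M1" if "xs < x" "x \<le> b" for x
    using M0[of x] M1[of x] that by auto
  have lim: "((\<lambda>x. (f x * h x - g x * k x) / of_real x) \<longlongrightarrow> (f xs * h xs - g xs * k xs) / of_real xs) (at_right xs)"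
    if "isCont f xs" "isCont g xs" "isCont h xs" "isCont k xs" for f g h k :: "real \<Rightarrow> complex"
  proof -
    note at = tendsto_within_subset[where S = UNIV and T = "{xs<..}", OF _ subset_UNIV]
    show ?thesis
      using that xs_pos unfolding isCont_def
      by (intro tendsto_divide tendsto_diff tendsto_mult at tendsto_of_real tendsto_ident_at) auto
  qed
  have l: "((\<lambda>x. (y0 lam x * z1 tau x - z0 lam x * y1 tau x) / of_real x) \<longlongrightarrow> 1 / of_real xs) (at_right xs)"
    "((\<lambda>x. (y0 tau x * z0 lam x - z0 tau x * y0 lam x) / of_real x) \<longlongrightarrow> 0) (at_right xs)"
    "((\<lambda>x. (y1 lam x * z1 tau x - z1 lam x * y1 tau x) / of_real x) \<longlongrightarrow> 0) (at_right xs)"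
    "((\<lambda>x. (y0 tau x * z1 lam x - z0 tau x * y1 lam x) / of_real x) \<longlongrightarrow> 1 / of_real xs) (at_right xs)"
    for lam
    using lim[of "y0 lam" "z0 lam" "z1 tau" "y1 tau"] lim[of "y0 tau" "z0 tau" "z0 lam" "y0 lam"]
      lim[of "y1 lam" "z1 lam" "z1 tau" "y1 tau"] lim[of "y0 tau" "z0 tau" "z1 lam" "y1 lam"]
    by (simp_all add: initial cont[OF xs_pos])
  have w: "complex_of_real (1 / xs) \<noteq> 0" using xs_pos by simp
  note pc = parameter_continuity[OF less_imp_le[OF xs_pos] b sol0 sol1 det w M]
  show "((\<lambda>lam. y0 lam b) \<longlongrightarrow> y0 tau b) (at tau)" "((\<lambda>lam. z0 lam b) \<longlongrightarrow> z0 tau b) (at tau)"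
    by (rule pc[where y = y0 and z = z0]; (rule sol0 l(1,2) | simp))+
  show "((\<lambda>lam. y1 lam b) \<longlongrightarrow> y1 tau b) (at tau)" "((\<lambda>lam. z1 lam b) \<longlongrightarrow> z1 tau b) (at tau)"
    by (rule pc[where y = y1 and z = z1]; (rule sol1 l(3,4) | simp))+
qed

end

lemma filterlim_Complex_at_right:
  "filterlim (\<lambda>\<epsilon>. Complex tau \<epsilon>) (at (of_real tau)) (at_right 0)"
proof -
  have "((\<lambda>\<epsilon>. of_real tau + \<i> * of_real \<epsilon>) \<longlongrightarrow> of_real tau + \<i> * of_real 0) (at_right 0)"
    by (intro tendsto_intros)
  then have "((\<lambda>\<epsilon>. Complex tau \<epsilon>) \<longlongrightarrow> of_real tau) (at_right 0)"
    by (simp add: complex_eq_iff Complex_eq)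
  then show ?thesis
    by (auto simp: filterlim_at eventually_at_filter complex_eq_iff)
qed

lemma wkb_ratio_continuous:
  assumes "0 < tau" "Einf / tau \<le> x"
  shows "((\<lambda>lam. wkb_ratio lam x) \<longlongrightarrow> wkb_ratio (of_real tau) x) (at (of_real tau))"
proof -
  have "1 \<le> tau / Einf * x" using assms Einf_pos by (simp add: field_simps)
  moreover have "Re (of_real (2 / Einf) * of_real x * of_real tau - 1 :: complex) = 2 * (tau / Einf * x) - 1"
    by simp
  ultimately have "0 < Re (of_real (2 / Einf) * of_real x * of_real tau - 1 :: complex)"
    by linarith
  then have "of_real (2 / Einf) * of_real x * of_real tau - 1 \<notin> (\<real>\<^sub>\<le>\<^sub>0 :: complex set)"
    by (simp only: complex_nonpos_Reals_iff) linarith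
  then have "isCont csqrt (of_real (2 / Einf) * of_real x * of_real tau - 1 :: complex)"
    by (rule continuous_at_csqrt)
  moreover have "((\<lambda>lam. of_real (2 / Einf) * of_real x * lam - 1) \<longlongrightarrow>
      of_real (2 / Einf) * of_real x * of_real tau - (1 :: complex)) (at (of_real tau))"
    by (intro tendsto_intros)
  ultimately have "((\<lambda>lam. wkb_root lam x) \<longlongrightarrow> wkb_root (of_real tau) x) (at (of_real tau))"
    unfolding wkb_root_def by (rule isCont_tendsto_compose)
  then show ?thesis
    unfolding wkb_ratio_def using assms(1) by (intro tendsto_intros) auto
qed

text \<open>The approximants converge as \<open>x \<rightarrow> \<infinity>\<close> at a rate that is uniform as \<open>\<epsilon> \<rightarrow> 0\<close>, which
  permits interchanging the two limits.\<close>

lemma (in normalized_system) weyl_boundary_limit: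
  assumes tau: "0 < tau"
  obtains Q where "0 < Im Q"
    "((\<lambda>\<epsilon>. weyl_m y0 y1 (Complex tau \<epsilon>)) \<longlongrightarrow> Q) (at_right 0)"
    "\<And>\<epsilon>. 0 < \<epsilon> \<Longrightarrow> \<epsilon> \<le> tau \<Longrightarrow>
      ((\<lambda>x. y0 (Complex tau \<epsilon>) x / y1 (Complex tau \<epsilon>) x) \<longlongrightarrow> - weyl_m y0 y1 (Complex tau \<epsilon>)) at_top"
proof -
  \<comment> \<open>A starting point that satisfies all lower bounds at once and does not depend on
    \<epsilon>.\<close>
  define X where "X = xs + 1 + Einf / tau"
  have X: "xs \<le> X" "xs < X" "1 \<le> X" "Einf / tau \<le> X"
    using xs_pos divide_pos_pos[OF Einf_pos tau] by (auto simp: X_def)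
  define L where "L \<epsilon> = Complex tau \<epsilon>" for \<epsilon>
  define q where "q \<epsilon> = weyl_approx (L \<epsilon>) (y0 (L \<epsilon>)) (z0 (L \<epsilon>)) (y1 (L \<epsilon>)) (z1 (L \<epsilon>))" for \<epsilon>
  define err where "err \<epsilon> = weyl_error tau (L \<epsilon>) (of_real (1 / xs)) (y1 (L \<epsilon>)) (z1 (L \<epsilon>)) X" for \<epsilon>
  have L0: "L 0 = of_real tau" by (simp add: L_def complex_of_real_def)
  have hs: "half_strip tau (L \<epsilon>)" if "0 \<le> \<epsilon>" "\<epsilon> \<le> tau" for \<epsilon>
    using that tau by (simp add: half_strip_def L_def)
  have w: "complex_of_real (1 / xs) \<noteq> 0" using xs_pos by simp
  note loc = sol0 sol1 det w xs_pos initial(3) X(1,3,4)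
  have "\<exists>Q. (q \<epsilon> \<longlongrightarrow> Q) at_top \<and> (\<forall>x\<ge>X. norm (Q - q \<epsilon> x) \<le> err \<epsilon> / sqrt x)"
    if e: "0 \<le> \<epsilon>" "\<epsilon> \<le> tau" for \<epsilon>
    using half_strip.weyl_approx_limit[OF hs[OF e] loc] unfolding q_def err_def by metis
  then obtain Q where Q: "\<And>\<epsilon>. 0 \<le> \<epsilon> \<Longrightarrow> \<epsilon> \<le> tau \<Longrightarrow> (q \<epsilon> \<longlongrightarrow> Q \<epsilon>) at_top"
    and Qb: "\<And>\<epsilon> x. 0 \<le> \<epsilon> \<Longrightarrow> \<epsilon> \<le> tau \<Longrightarrow> X \<le> x \<Longrightarrow> norm (Q \<epsilon> - q \<epsilon> x) \<le> err \<epsilon> / sqrt x"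
    by metis
  have ratio: "((\<lambda>x. y0 (L \<epsilon>) x / y1 (L \<epsilon>) x) \<longlongrightarrow> - Q \<epsilon>) at_top" if e: "0 < \<epsilon>" "\<epsilon> \<le> tau" for \<epsilon>
    using half_strip.weyl_ratio_limit[OF hs loc Q[unfolded q_def]] e by (simp add: L_def)
  then have m: "weyl_m y0 y1 (L \<epsilon>) = Q \<epsilon>" if "0 < \<epsilon>" "\<epsilon> \<le> tau" for \<epsilon>
    using tendsto_Lim[OF _ ratio[OF that]] by (simp add: weyl_m_def)
  have flim: "filterlim L (at (of_real tau)) (at_right 0)"
    unfolding L_def [abs_def] by (rule filterlim_Complex_at_right)
  have B0: "y1 (L 0) x - wkb_ratio (L 0) x * z1 (L 0) x \<noteq> 0" if "X \<le> x" for x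
    using half_strip.weyl_denominator_nonzero[OF hs loc that, of 0] tau by simp
  have cont: "((\<lambda>\<epsilon>. y0 (L \<epsilon>) x - wkb_ratio (L \<epsilon>) x * z0 (L \<epsilon>) x) \<longlongrightarrow> y0 (L 0) x - wkb_ratio (L 0) x * z0 (L 0) x) (at_right 0)"
    "((\<lambda>\<epsilon>. y1 (L \<epsilon>) x - wkb_ratio (L \<epsilon>) x * z1 (L \<epsilon>) x) \<longlongrightarrow> y1 (L 0) x - wkb_ratio (L 0) x * z1 (L 0) x) (at_right 0)"
    if x: "X \<le> x" for x
  proof -
    have b: "xs < x" "Einf / tau \<le> x" using X x by auto
    note c = continuous_in_parameter[OF b(1), of "of_real tau", THEN filterlim_compose, OF flim]
      wkb_ratio_continuous[OF tau b(2), THEN filterlim_compose, OF flim]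
    show "((\<lambda>\<epsilon>. y0 (L \<epsilon>) x - wkb_ratio (L \<epsilon>) x * z0 (L \<epsilon>) x) \<longlongrightarrow> y0 (L 0) x - wkb_ratio (L 0) x * z0 (L 0) x) (at_right 0)"
      "((\<lambda>\<epsilon>. y1 (L \<epsilon>) x - wkb_ratio (L \<epsilon>) x * z1 (L \<epsilon>) x) \<longlongrightarrow> y1 (L 0) x - wkb_ratio (L 0) x * z1 (L 0) x) (at_right 0)"
      unfolding L0 by (intro tendsto_diff tendsto_mult c)+
  qed
  have q_cont: "((\<lambda>\<epsilon>. q \<epsilon> x) \<longlongrightarrow> q 0 x) (at_right 0)" if x: "X \<le> x" for x
    unfolding q_def weyl_approx_def by (intro tendsto_minus tendsto_divide cont B0 x)
  \<comment> \<open>Continuity at \<epsilon> = 0 bounds the error constants by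
    \<open>err 0 + 1\<close> for all small \<epsilon>, which is the uniformity of the rate.\<close>
  have "(err \<longlongrightarrow> err 0) (at_right 0)"
    unfolding err_def [abs_def] weyl_error_def
    using growth_weight_pos[of X "growth_const tau"] B0[of X] X
    by (intro tendsto_mult tendsto_divide tendsto_const tendsto_power tendsto_norm cont(2)[OF order_refl]) auto
  then have err: "\<forall>\<^sub>F \<epsilon> in at_right 0. err \<epsilon> < err 0 + 1"
    by (rule order_tendstoD) simp
  have small: "\<forall>\<^sub>F \<epsilon> in at_right 0. 0 < \<epsilon> \<and> \<epsilon> \<le> tau"
    using eventually_at_right_real[OF tau] by eventually_elim auto
  have "(Q \<longlongrightarrow> Q 0) (at_right 0)"
  proof (rule tendstoI)
    fix e :: real assume e: "0 < e"
    have "((\<lambda>x. (err 0 + 1) / sqrt x) \<longlongrightarrow> 0) at_top"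
      by (rule tendsto_divide_0[OF tendsto_const filterlim_at_top_imp_at_infinity[OF sqrt_at_top]])
    then have "\<forall>\<^sub>F x in at_top. (err 0 + 1) / sqrt x < e / 3"
      by (rule order_tendstoD) (use e in simp)
    then have "\<forall>\<^sub>F x in at_top. (err 0 + 1) / sqrt x < e / 3 \<and> X \<le> x"
      using eventually_ge_at_top[of X] by (rule eventually_conj)
    \<comment> \<open>The point \<open>x\<close> is chosen before \<epsilon>; the distance of
      \<open>Q \<epsilon>\<close> and \<open>Q 0\<close> then splits into two tails and one
      difference at this fixed point.\<close>
    then obtain x where x: "(err 0 + 1) / sqrt x < e / 3" "X \<le> x"
      using eventually_happens' trivial_limit_at_top_linorder by blast
    have x0: "0 < sqrt x" using X x by simp
    have near: "norm (Q \<epsilon> - q \<epsilon> x) < e / 3" if "0 \<le> \<epsilon>" "\<epsilon> \<le> tau" "err \<epsilon> < err 0 + 1" for \<epsilon>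
    proof -
      have "err \<epsilon> / sqrt x \<le> (err 0 + 1) / sqrt x" using that x0 by (intro divide_right_mono) auto
      then show ?thesis using Qb[OF that(1,2) x(2)] x(1) by linarith
    qed
    have "\<forall>\<^sub>F \<epsilon> in at_right 0. dist (q \<epsilon> x) (q 0 x) < e / 3"
      by (rule tendstoD[OF q_cont[OF x(2)]]) (use e in simp)
    then show "\<forall>\<^sub>F \<epsilon> in at_right 0. dist (Q \<epsilon>) (Q 0) < e"
      using err small
    proof eventually_elim
      case (elim \<epsilon>)
      have "norm (Q \<epsilon> - q \<epsilon> x) < e / 3" "norm (Q 0 - q 0 x) < e / 3"
        using near[of \<epsilon>] near[of 0] elim tau by auto
      then show ?case
        using elim(1) norm_triangle_ineq[of "Q \<epsilon> - q \<epsilon> x" "q \<epsilon> x - q 0 x"]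
          norm_triangle_ineq4[of "Q \<epsilon> - q 0 x" "Q 0 - q 0 x"]
        by (simp add: dist_norm)
    qed
  qed
  then have lim: "((\<lambda>\<epsilon>. weyl_m y0 y1 (Complex tau \<epsilon>)) \<longlongrightarrow> Q 0) (at_right 0)"
    by (rule Lim_transform_eventually)
      (use small in eventually_elim, simp add: m L_def[symmetric])
  have pos: "0 < Im (Q 0)"
  proof (rule half_strip.weyl_limit_Im_pos[OF hs loc])
    show "(weyl_approx (L 0) (y0 (L 0)) (z0 (L 0)) (y1 (L 0)) (z1 (L 0)) \<longlongrightarrow> Q 0) at_top"
      using Q[of 0] tau by (simp add: q_def)
    show "Im (L 0) = 0" by (simp add: L0)
    show "complex_of_real (1 / xs) = of_real (1 / xs)" ..
    show "y0 (L 0) x \<in> \<real> \<and> z0 (L 0) x \<in> \<real> \<and> y1 (L 0) x \<in> \<real> \<and> z1 (L 0) x \<in> \<real>" if "0 < x" for x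
      unfolding L0 by (rule real_parameter[OF that])
  qed (use tau xs_pos in auto)
  show thesis
    by (rule that[OF pos lim]) (use ratio m in \<open>simp add: L_def[symmetric]\<close>)
qed

section \<open>The Moebius transformation and the formulas for the spectral density\<close>

lemma mat22_mult:
  "mat22 p q r s ** mat22 p' q' r' s'
    = mat22 (p * p' + q * r') (p * q' + q * s') (r * p' + s * r') (r * q' + s * s')"
  by (simp add: mat22_def matrix_matrix_mult_def vec_eq_iff forall_2 sum_2 vector_2)

lemma mat22_eq_iff:
  "mat22 p q r s = mat22 p' q' r' s' \<longleftrightarrow> p = p' \<and> q = q' \<and> r = r' \<and> s = s'"
  by (auto simp: mat22_def vec_eq_iff forall_2 vector_2)

lemma mat22_one: "mat 1 = mat22 1 0 0 1"
  by (simp add: mat22_def mat_def vec_eq_iff forall_2 vector_2)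

lemma real_affine_nonzero:
  fixes M :: complex
  assumes "Im M \<noteq> 0" "p \<noteq> 0 \<or> q \<noteq> (0::real)"
  shows "of_real p + of_real q * M \<noteq> 0"
  using assms by (auto simp: complex_eq_iff)

text \<open>The rotation by \<open>(a, b)\<close> turns \<open>M\<close> into \<open>\<mu>\<close>, the diagonal factor scales it by \<open>\<alpha>\<^sup>-\<^sup>2\<close>,
  and the rotation by \<open>(c, d)\<close> gives the two equivalent expressions.\<close>

lemma svd_moebius:
  fixes M :: complex and a b c d al s :: real
  assumes M: "0 < Im M" and ab: "a ^ 2 + b ^ 2 = 1" and cd: "c ^ 2 + d ^ 2 = 1"
    and al: "0 < al" and s: "0 < s"
  defines "mu \<equiv> (of_real a + of_real b * M) / (of_real b - of_real a * M)"
    and "E \<equiv> complex_of_real (al ^ 2 * d) * (of_real b - of_real a * M) + of_real c * (of_real a + of_real b * M)"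
    and "f0 \<equiv> complex_of_real (s * (a * al * c + b * d / al))"
    and "f1 \<equiv> complex_of_real (s * (a * al * d - b * c / al))"
    and "g0 \<equiv> complex_of_real (s * (b * al * c - a * d / al))"
    and "g1 \<equiv> complex_of_real (s * (b * al * d + a * c / al))"
  shows "g1 - M * f1 \<noteq> 0"
    and "d \<noteq> 0 \<Longrightarrow> (M * f0 - g0) / (g1 - M * f1)
      = - of_real (c / d) + (1 + of_real (c / d) ^ 2) / (of_real (al ^ 2) * inverse mu + of_real (c / d))"
    and "c \<noteq> 0 \<Longrightarrow> (M * f0 - g0) / (g1 - M * f1)
      = of_real (d / c) - (1 + of_real (d / c) ^ 2) / (of_real (inverse (al ^ 2)) * mu + of_real (d / c))"
proof -
  let ?N = "of_real a + of_real b * M" and ?D = "of_real b - of_real a * M"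
  have ab0: "a \<noteq> 0 \<or> b \<noteq> 0" using ab by auto
  have N: "?N \<noteq> 0" using real_affine_nonzero[of M a b] M ab0 by simp
  have D: "?D \<noteq> 0" using real_affine_nonzero[of M b "- a"] M ab0 by auto
  have E: "E \<noteq> 0"
  proof -
    let ?p = "al ^ 2 * d * b + c * a" and ?q = "c * b - al ^ 2 * d * a"
    have "?p \<noteq> 0 \<or> ?q \<noteq> 0"
    proof (rule ccontr)
      assume "\<not> ?thesis"
      then have pq: "?p = 0" "?q = 0" by auto
      \<comment> \<open>Up to signs and order, the two coefficients arise from
        \<open>al ^ 2 * d\<close> and \<open>c\<close> by the rotation with entries \<open>a\<close>
        and \<open>b\<close>; inverting it shows that both cannot vanish.\<close>
      have "al ^ 2 * d * (a ^ 2 + b ^ 2) = b * ?p - a * ?q" "c * (a ^ 2 + b ^ 2) = a * ?p + b * ?q"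
        by (simp_all add: algebra_simps power2_eq_square)
      then have "al ^ 2 * d = 0" "c = 0" using pq ab by simp_all
      then show False using al cd by simp
    qed
    then have "of_real ?p + of_real ?q * M \<noteq> 0" using M by (intro real_affine_nonzero) auto
    moreover have "E = of_real ?p + of_real ?q * M" by (simp add: E_def algebra_simps)
    ultimately show ?thesis by simp
  qed
  have k: "of_real (s / al) \<noteq> (0 :: complex)" using s al by simp
  have den: "g1 - M * f1 = of_real (s / al) * E"
    using al by (simp add: g1_def f1_def E_def field_simps power2_eq_square)
  have num: "M * f0 - g0 = of_real (s / al) * (of_real d * ?N - of_real (al ^ 2 * c) * ?D)"
    using al by (simp add: g0_def f0_def field_simps power2_eq_square)
  show "g1 - M * f1 \<noteq> 0" unfolding den using k E by simp
  have m: "(M * f0 - g0) / (g1 - M * f1) = (of_real d * ?N - of_real (al ^ 2 * c) * ?D) / E"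
    unfolding den num by (rule mult_divide_mult_cancel_left[OF k])
  \<comment> \<open>Opaque names keep \<open>field_simps\<close> from expanding the two affine
    expressions.\<close>
  obtain N' where N': "N' = ?N" by blast
  obtain D' where D': "D' = ?D" by blast
  have E': "E = of_real (al ^ 2 * d) * D' + of_real c * N'" by (simp add: E_def N' D')
  have al0: "complex_of_real al \<noteq> 0" using al by simp
  show "(M * f0 - g0) / (g1 - M * f1)
      = - of_real (c / d) + (1 + of_real (c / d) ^ 2) / (of_real (al ^ 2) * inverse mu + of_real (c / d))"
    if d: "d \<noteq> 0"
  proof -
    have "of_real (al ^ 2) * inverse mu + of_real (c / d) = E / (N' * of_real d)"
      using N D d unfolding mu_def N'[symmetric] D'[symmetric] E' by (simp add: field_simps)
    then have "- of_real (c / d) + (1 + of_real (c / d) ^ 2) / (of_real (al ^ 2) * inverse mu + of_real (c / d))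
        = - of_real (c / d) + (1 + of_real (c / d) ^ 2) * (N' * of_real d) / E"
      by simp
    also have "\<dots> = (- of_real c * E + (of_real c ^ 2 + of_real d ^ 2) * N') / (of_real d * E)"
      using d E by (simp add: field_simps power2_eq_square)
    also have "- of_real c * E + (of_real c ^ 2 + of_real d ^ 2) * N'
        = of_real d * (of_real d * N' - of_real (al ^ 2 * c) * D')"
      unfolding E' by (simp add: algebra_simps power2_eq_square)
    finally show ?thesis using d unfolding m N'[symmetric] D'[symmetric] by simp
  qed
  show "(M * f0 - g0) / (g1 - M * f1)
      = of_real (d / c) - (1 + of_real (d / c) ^ 2) / (of_real (inverse (al ^ 2)) * mu + of_real (d / c))"
    if c: "c \<noteq> 0"
  proof -
    have "of_real (inverse (al ^ 2)) * mu + of_real (d / c) = E / (of_real (al ^ 2) * D' * of_real c)"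
      using N D c al0 unfolding mu_def N'[symmetric] D'[symmetric] E' by (simp add: field_simps)
    then have "of_real (d / c) - (1 + of_real (d / c) ^ 2) / (of_real (inverse (al ^ 2)) * mu + of_real (d / c))
        = of_real (d / c) - (1 + of_real (d / c) ^ 2) * (of_real (al ^ 2) * D' * of_real c) / E"
      by simp
    also have "\<dots> = (of_real d * E - (of_real c ^ 2 + of_real d ^ 2) * (of_real (al ^ 2) * D')) / (of_real c * E)"
      using c E by (simp add: field_simps power2_eq_square)
    also have "of_real d * E - (of_real c ^ 2 + of_real d ^ 2) * (of_real (al ^ 2) * D')
        = of_real c * (of_real d * N' - of_real (al ^ 2 * c) * D')"
      unfolding E' by (simp add: algebra_simps power2_eq_square)
    finally show ?thesis using c unfolding m N'[symmetric] D'[symmetric] by simp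
  qed
qed

text \<open>Expand \<open>y0\<close> and \<open>y1\<close> in the normalized basis and divide
  numerator and denominator by \<open>yt1\<close>; the quotient \<open>yt0 / yt1\<close> then tends
  to \<open>- M\<close>.\<close>

lemma weyl_m_change_of_basis:
  assumes "normalized_system xs yt0 zt0 yt1 zt1"
    and sol0: "system_solution {0<..} lam (y0 lam) (z0 lam)"
    and sol1: "system_solution {0<..} lam (y1 lam) (z1 lam)"
    and lim: "((\<lambda>x. yt0 lam x / yt1 lam x) \<longlongrightarrow> - M) at_top" and M: "M \<noteq> 0"
    and den: "z1 lam xs - M * y1 lam xs \<noteq> 0"
  shows "weyl_m y0 y1 lam = (M * y0 lam xs - z0 lam xs) / (z1 lam xs - M * y1 lam xs)"
proof -
  interpret tilde: normalized_system xs yt0 zt0 yt1 zt1 by fact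
  \<comment> \<open>A quotient with denominator 0 has the value 0, so a nonzero limit shows that
    \<open>yt1 lam x\<close> is eventually nonzero.\<close>
  have "\<forall>\<^sub>F x in at_top. yt0 lam x / yt1 lam x \<noteq> 0"
    using tendsto_imp_eventually_ne[OF lim, of 0] M by simp
  then have ev: "\<forall>\<^sub>F x in at_top. (yt0 lam x / yt1 lam x * y0 lam xs + z0 lam xs)
      / (yt0 lam x / yt1 lam x * y1 lam xs + z1 lam xs) = y0 lam x / y1 lam x"
    using eventually_gt_at_top[of 0]
  proof eventually_elim
    case (elim x)
    then have "yt1 lam x \<noteq> 0" by auto
    then have "yt0 lam x / yt1 lam x * y0 lam xs + z0 lam xs = y0 lam x / yt1 lam x"
      "yt0 lam x / yt1 lam x * y1 lam xs + z1 lam xs = y1 lam x / yt1 lam x"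
      using tilde.solution_expansion(1)[OF sol0 elim(2)] tilde.solution_expansion(1)[OF sol1 elim(2)]
      by (simp_all add: field_simps)
    then show ?case using \<open>yt1 lam x \<noteq> 0\<close> by simp
  qed
  have "((\<lambda>x. (yt0 lam x / yt1 lam x * y0 lam xs + z0 lam xs)
      / (yt0 lam x / yt1 lam x * y1 lam xs + z1 lam xs)) \<longlongrightarrow>
      (- M * y0 lam xs + z0 lam xs) / (- M * y1 lam xs + z1 lam xs)) at_top"
    by (intro tendsto_intros lim) (use den in simp)
  from Lim_transform_eventually[OF this ev]
  have "Lim at_top (\<lambda>x. y0 lam x / y1 lam x) = (- M * y0 lam xs + z0 lam xs) / (- M * y1 lam xs + z1 lam xs)"
    by (intro tendsto_Lim) auto
  moreover have "- ((- M * y0 lam xs + z0 lam xs) / (- M * y1 lam xs + z1 lam xs))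
      = (M * y0 lam xs - z0 lam xs) / (z1 lam xs - M * y1 lam xs)"
    by (simp add: minus_divide_left)
  ultimately show ?thesis by (simp only: weyl_m_def)
qed

theorem mainTheorem4:
  fixes y0 z0 y1 z1 yt0 zt0 yt1 zt1 :: "complex \<Rightarrow> real \<Rightarrow> complex"
    and \<tau> xs a b c d \<alpha> :: real
  assumes even_sol: "\<And>lam. even_solution lam (y0 lam) (z0 lam)"
    and odd_sol: "\<And>lam. odd_solution lam (y1 lam) (z1 lam)"
    and tau_pos: "\<tau> > 0"
    and xs_extremum: "first_negative_extremum (\<lambda>x. Re (y1 (of_real \<tau>) x)) xs"
    and tilde_sol0: "\<And>lam. system_solution {0<..} lam (yt0 lam) (zt0 lam)"
    and tilde_sol1: "\<And>lam. system_solution {0<..} lam (yt1 lam) (zt1 lam)"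
    and tilde_init: "\<And>lam. mat22 (yt0 lam xs) (yt1 lam xs) (zt0 lam xs) (zt1 lam xs) = mat 1"
    and svd: "mat22 (y0 (of_real \<tau>) xs) (y1 (of_real \<tau>) xs)
                    (z0 (of_real \<tau>) xs) (z1 (of_real \<tau>) xs)
              = mat22 (of_real a) (- of_real b) (of_real b) (of_real a)
                ** mat22 (of_real (\<alpha> * sqrt xs)) 0 0 (of_real (inverse \<alpha> * sqrt xs))
                ** mat22 (of_real c) (of_real d) (- of_real d) (of_real c)"
    and ab: "a ^ 2 + b ^ 2 = 1" and cd: "c ^ 2 + d ^ 2 = 1" and alpha_pos: "\<alpha> > 0"
  defines "m \<equiv> weyl_m y0 y1"
    and "mt \<equiv> upper_limit (weyl_m yt0 yt1) \<tau>"
    and "\<beta> \<equiv> complex_of_real (c / d)"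
    and "\<beta>inv \<equiv> complex_of_real (d / c)"
  defines "\<mu> \<equiv> (of_real a + of_real b * mt) / (of_real b - of_real a * mt)"
  shows "(d \<noteq> 0 \<longrightarrow>
            upper_limit m \<tau> = - \<beta> + (1 + \<beta> ^ 2) / (of_real (\<alpha> ^ 2) * inverse \<mu> + \<beta>)) \<and>
         (c \<noteq> 0 \<longrightarrow>
            upper_limit m \<tau> = \<beta>inv - (1 + \<beta>inv ^ 2) / (of_real (inverse (\<alpha> ^ 2)) * \<mu> + \<beta>inv)) \<and>
         spectral_density m \<tau> =
           (if d \<noteq> 0 \<and> \<bar>c / d\<bar> \<le> 1
            then 1 / pi * Im ((1 + \<beta> ^ 2) / (of_real (\<alpha> ^ 2) * inverse \<mu> + \<beta>))
            else - (1 / pi) * Im ((1 + \<beta>inv ^ 2) / (of_real (inverse (\<alpha> ^ 2)) * \<mu> + \<beta>inv)))"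
proof -
  let ?t = "complex_of_real \<tau>" and ?L = "\<lambda>\<epsilon>. Complex \<tau> \<epsilon>"
  have xs: "0 < xs" using xs_extremum by (simp add: first_negative_extremum_def)
  have ini: "yt0 lam xs = 1" "zt0 lam xs = 0" "yt1 lam xs = 0" "zt1 lam xs = 1" for lam
    using tilde_init[of lam] by (simp_all add: mat22_one mat22_eq_iff)
  have ns: "normalized_system xs yt0 zt0 yt1 zt1"
    by (intro normalized_system.intro xs tilde_sol0 tilde_sol1 ini)
  obtain M where M: "0 < Im M" "((\<lambda>\<epsilon>. weyl_m yt0 yt1 (?L \<epsilon>)) \<longlongrightarrow> M) (at_right 0)"
    and ratio: "\<And>\<epsilon>. 0 < \<epsilon> \<Longrightarrow> \<epsilon> \<le> \<tau> \<Longrightarrow>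
      ((\<lambda>x. yt0 (?L \<epsilon>) x / yt1 (?L \<epsilon>) x) \<longlongrightarrow> - weyl_m yt0 yt1 (?L \<epsilon>)) at_top"
    using normalized_system.weyl_boundary_limit[OF ns tau_pos] by blast
  have M0: "M \<noteq> 0" using M(1) by auto
  have mt: "mt = M"
    unfolding mt_def upper_limit_def by (rule tendsto_Lim[OF _ M(2)]) simp
  have sx: "0 < sqrt xs" using xs by simp
  have \<Phi>: "y0 ?t xs = of_real (sqrt xs * (a * \<alpha> * c + b * d / \<alpha>))"
    "y1 ?t xs = of_real (sqrt xs * (a * \<alpha> * d - b * c / \<alpha>))"
    "z0 ?t xs = of_real (sqrt xs * (b * \<alpha> * c - a * d / \<alpha>))"
    "z1 ?t xs = of_real (sqrt xs * (b * \<alpha> * d + a * c / \<alpha>))"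
    using svd unfolding mat22_mult mat22_eq_iff by (simp_all add: algebra_simps divide_inverse)
  note moebius = svd_moebius[OF M(1) ab cd alpha_pos sx, folded \<Phi>, folded mt, folded \<mu>_def, folded \<beta>_def \<beta>inv_def, unfolded mt]
  note lims = even_odd_parameter_continuity[OF even_sol odd_sol xs, of ?t, THEN filterlim_compose,
      OF filterlim_Complex_at_right]
  have den: "((\<lambda>\<epsilon>. z1 (?L \<epsilon>) xs - weyl_m yt0 yt1 (?L \<epsilon>) * y1 (?L \<epsilon>) xs) \<longlongrightarrow> z1 ?t xs - M * y1 ?t xs) (at_right 0)"
    by (intro tendsto_diff tendsto_mult lims M(2))
  have "((\<lambda>\<epsilon>. (weyl_m yt0 yt1 (?L \<epsilon>) * y0 (?L \<epsilon>) xs - z0 (?L \<epsilon>) xs)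
      / (z1 (?L \<epsilon>) xs - weyl_m yt0 yt1 (?L \<epsilon>) * y1 (?L \<epsilon>) xs)) \<longlongrightarrow>
      (M * y0 ?t xs - z0 ?t xs) / (z1 ?t xs - M * y1 ?t xs)) (at_right 0)"
    by (intro tendsto_divide den tendsto_diff tendsto_mult lims M(2) moebius(1))
  moreover have "\<forall>\<^sub>F \<epsilon> in at_right 0. (weyl_m yt0 yt1 (?L \<epsilon>) * y0 (?L \<epsilon>) xs - z0 (?L \<epsilon>) xs)
      / (z1 (?L \<epsilon>) xs - weyl_m yt0 yt1 (?L \<epsilon>) * y1 (?L \<epsilon>) xs) = m (?L \<epsilon>)"
    \<comment> \<open>For small \<epsilon> the denominator and the value of the normalized Weyl
      function are nonzero, since their limits are.\<close>
    using tendsto_imp_eventually_ne[OF den moebius(1)]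
      tendsto_imp_eventually_ne[OF M(2) M0] eventually_at_right_real[OF tau_pos]
  proof eventually_elim
    case (elim \<epsilon>)
    have sol: "system_solution {0<..} (?L \<epsilon>) (y0 (?L \<epsilon>)) (z0 (?L \<epsilon>))"
      "system_solution {0<..} (?L \<epsilon>) (y1 (?L \<epsilon>)) (z1 (?L \<epsilon>))"
      using even_odd_initial(1)[OF even_sol] even_odd_initial(2)[OF odd_sol] by blast+
    have "0 < \<epsilon>" "\<epsilon> \<le> \<tau>" using elim(3) by auto
    then show ?case
      unfolding m_def
      using weyl_m_change_of_basis[where lam = "?L \<epsilon>" and ?y0.0 = y0 and ?z0.0 = z0 and ?y1.0 = y1 and ?z1.0 = z1
          and ?yt0.0 = yt0 and ?zt0.0 = zt0 and ?yt1.0 = yt1 and ?zt1.0 = zt1,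
          OF ns sol ratio elim(2) elim(1)] by simp
  qed
  ultimately have "((\<lambda>\<epsilon>. m (?L \<epsilon>)) \<longlongrightarrow>
      (M * y0 ?t xs - z0 ?t xs) / (z1 ?t xs - M * y1 ?t xs)) (at_right 0)"
    by (rule Lim_transform_eventually)
  then have up: "upper_limit m \<tau> = (M * y0 ?t xs - z0 ?t xs) / (z1 ?t xs - M * y1 ?t xs)"
    unfolding upper_limit_def by (intro tendsto_Lim) auto
  have 1: "upper_limit m \<tau> = - \<beta> + (1 + \<beta> ^ 2) / (of_real (\<alpha> ^ 2) * inverse \<mu> + \<beta>)" if "d \<noteq> 0"
    unfolding up by (rule moebius(2)[OF that])
  have 2: "upper_limit m \<tau> = \<beta>inv - (1 + \<beta>inv ^ 2) / (of_real (inverse (\<alpha> ^ 2)) * \<mu> + \<beta>inv)" if "c \<noteq> 0"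
    unfolding up by (rule moebius(3)[OF that])
  \<comment> \<open>The real summands \<open>- \<beta>\<close> and \<open>\<beta>inv\<close>
    disappear from the imaginary part.\<close>
  have Im0: "Im \<beta> = 0" "Im \<beta>inv = 0" by (simp_all only: \<beta>_def \<beta>inv_def Im_complex_of_real)
  \<comment> \<open>Either \<open>d = 0\<close> and the normalization gives
    \<open>c \<noteq> 0\<close>, or the quotient \<open>c / d\<close> exceeds 1 in modulus.\<close>
  have "c \<noteq> 0" if "\<not> (d \<noteq> 0 \<and> \<bar>c / d\<bar> \<le> 1)" using that cd by auto
  then have "spectral_density m \<tau> =
      (if d \<noteq> 0 \<and> \<bar>c / d\<bar> \<le> 1
       then 1 / pi * Im ((1 + \<beta> ^ 2) / (of_real (\<alpha> ^ 2) * inverse \<mu> + \<beta>))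
       else - (1 / pi) * Im ((1 + \<beta>inv ^ 2) / (of_real (inverse (\<alpha> ^ 2)) * \<mu> + \<beta>inv)))"
    using 1 2 Im0 unfolding spectral_density_def by auto
  with 1 2 show ?thesis by blast
qed

end
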